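(* Let $\lambda>0$, $\mu>0$, $i\in\mathbb{N}\cup\{0\}$ and $\alpha\in(0,1]$. Let $N^1(t)$, $t\ge0$, be the classical M/M/1 queue with arrival rate $\lambda$, service rate $\mu$ and $N^1(0)=i$, and let $E^\alpha(t)$, $t\ge 0$, be an inverse $\alpha$-stable subordinator independent of $N^1$. Then the fractional M/M/1 queue $N^\alpha(t)$ with parameter $\alpha$, rates $\lambda,\mu$ and $i$ initial customers can be represented as $$N^\alpha(t)=N^1(E^\alpha(t)),\qquad t\ge0,$$ where the equality holds for the one-dimensional distributions; that is, $\Pr\{N^1(E^\alpha(t))=k\}=p_k^\alpha(t)$ for all $k\ge0$ and $t\ge0$, where $p_k^\alpha(t)$ are the state probabilities of the fractional M/M/1 queue.
   Context: For $\alpha\in(0,1)$ the Caputo fractional derivative is $D_t^\alpha f(t)=\frac{1}{\Gamma(1-\alpha)}\int_0^t (t-y)^{-\alpha} f'(y)\,\mathrm dy$, and $D_t^1=\mathrm d/\mathrm dt$. The fractional M/M/1 queue $N^\alpha(t)$, $t\ge0$, with parameter $\alpha\in(0,1]$, arrival rate $\lambda>0$, service rate $\mu>0$ and $i\ge 0$ initial customers, is defined through its state probabilities $p_k^\alpha(t)=\Pr\{N^\alpha(t)=k\mid N^\alpha(0)=i\}$, $k\ge0$ (a probability distribution on $\{0,1,2,\dots\}$ for each $t$), which solve $$\begin{cases} D_t^\alpha p_k^\alpha(t)=-(\lambda+\mu)p_k^\alpha(t)+\lambda p_{k-1}^\alpha(t)+\mu p_{k+1}^\alpha(t), & k\ge1,\\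 D_t^\alpha p_0^\alpha(t)=-\lambda p_0^\alpha(t)+\mu p_1^\alpha(t),\\ p_k^\alpha(0)=\delta_{k,i},\end{cases}$$ with $\delta_{k,i}$ the Kronecker delta. The case $\alpha=1$ is the classical M/M/1 queue. The $\alpha$-stable subordinator $V^\alpha(t)$, $t\ge0$, is the nondecreasing Lévy process with $\mathbb{E}e^{-\xi V^\alpha(t)}=e^{-t\xi^\alpha}$, $\xi>0$ (for $\alpha=1$, $V^1(t)=t$). The inverse $\alpha$-stable subordinator is $E^\alpha(t)=\inf\{s>0: V^\alpha(s)>t\}$. *)

theory Defs
  imports "HOL-Probability.Probability"
begin

text \<open>
  For order in (0,1) the Caputo derivative is used for functions that are continuous on
  the closed half-line, differentiable on the open one (the solutions of interest behave like a
  constant plus a multiple of t powr \<alpha> at 0, so no derivative at 0 may be required), and for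
  which the defining integral converges absolutely at every positive time. Order 1 is the
  ordinary derivative.
\<close>

definition caputo_differentiable :: "real \<Rightarrow> (real \<Rightarrow> real) \<Rightarrow> bool" where
  "caputo_differentiable \<alpha> f \<longleftrightarrow>
     continuous_on {0..} f \<and>
     (\<forall>t>0. f differentiable at t) \<and>
     (\<alpha> < 1 \<longrightarrow>
       (\<forall>t>0. set_integrable lborel {0<..<t} (\<lambda>y. (t - y) powr (- \<alpha>) * deriv f y)))"

definition caputo_deriv :: "real \<Rightarrow> (real \<Rightarrow> real) \<Rightarrow> real \<Rightarrow> real" where
  "caputo_deriv \<alpha> f t =
     (if \<alpha> = 1 then deriv f t
      else 1 / Gamma (1 - \<alpha>) * (LBINT y:{0<..<t}. (t - y) powr (- \<alpha>) * deriv f y))"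

text \<open>
  The equations are imposed for t > 0 only: for order less than 1 the Caputo integral at t = 0
  is over an empty interval, whereas the right-hand sides need not vanish there.
\<close>

definition fractional_MM1_probs ::
    "real \<Rightarrow> real \<Rightarrow> real \<Rightarrow> nat \<Rightarrow> (nat \<Rightarrow> real \<Rightarrow> real) \<Rightarrow> bool" where
  "fractional_MM1_probs \<alpha> lam \<mu> i p \<longleftrightarrow>
     (\<forall>t\<ge>0. (\<forall>k. 0 \<le> p k t) \<and> (\<lambda>k. p k t) sums 1) \<and>
     (\<forall>k. caputo_differentiable \<alpha> (p k)) \<and>
     (\<forall>t>0. \<forall>k\<ge>1. caputo_deriv \<alpha> (p k) t =
        - (lam + \<mu>) * p k t + lam * p (k - 1) t + \<mu> * p (k + 1) t) \<and>
     (\<forall>t>0. caputo_deriv \<alpha> (p 0) t = - lam * p 0 t + \<mu> * p 1 t) \<and>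
     (\<forall>k. p k 0 = (if k = i then 1 else 0))"

text \<open>
  Processes are indexed by real numbers, but only times t \<ge> 0 matter. The initial
  condition makes N 0 equal to i almost surely, so conditioning on it is superfluous.
\<close>

definition fractional_MM1_queue ::
    "'a measure \<Rightarrow> real \<Rightarrow> real \<Rightarrow> real \<Rightarrow> nat \<Rightarrow> (real \<Rightarrow> 'a \<Rightarrow> nat) \<Rightarrow> bool" where
  "fractional_MM1_queue M \<alpha> lam \<mu> i N \<longleftrightarrow>
     (\<forall>t\<ge>0. N t \<in> measurable M (count_space UNIV)) \<and>
     fractional_MM1_probs \<alpha> lam \<mu> i (\<lambda>k t. measure M {\<omega> \<in> space M. N t \<omega> = k})"

text \<open>
  The classical queue is the case of order 1, in its usual version with right-continuous paths.
  Path regularity is needed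
  for a random time change: modifying N at an independent, continuously distributed time alters
  none of the laws of N at fixed times, but it does alter N evaluated at that time. The Markov
  property is not required, since the state probabilities determine the one-dimensional laws.
\<close>

definition MM1_queue ::
    "'a measure \<Rightarrow> real \<Rightarrow> real \<Rightarrow> nat \<Rightarrow> (real \<Rightarrow> 'a \<Rightarrow> nat) \<Rightarrow> bool" where
  "MM1_queue M lam \<mu> i N \<longleftrightarrow>
     fractional_MM1_queue M 1 lam \<mu> i N \<and>
     (\<forall>\<omega>\<in>space M. \<forall>t\<ge>0. continuous (at_right t) (\<lambda>s. N s \<omega>))"

text \<open>
  Left limits of the paths, part of the definition of a Levy process, exist by monotonicity.
\<close>

definition stable_subordinator ::
    "'a measure \<Rightarrow> real \<Rightarrow> (real \<Rightarrow> 'a \<Rightarrow> real) \<Rightarrow> bool" where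
  "stable_subordinator M \<alpha> V \<longleftrightarrow>
     (\<forall>t\<ge>0. V t \<in> borel_measurable M) \<and>
     (AE \<omega> in M. V 0 \<omega> = 0) \<and>
     (\<forall>n (t :: nat \<Rightarrow> real). mono t \<and> 0 \<le> t 0 \<longrightarrow>
        prob_space.indep_vars M (\<lambda>_. borel) (\<lambda>j \<omega>. V (t (Suc j)) \<omega> - V (t j) \<omega>) {..<n}) \<and>
     (\<forall>s t. 0 \<le> s \<and> s \<le> t \<longrightarrow>
        distr M borel (\<lambda>\<omega>. V t \<omega> - V s \<omega>) = distr M borel (V (t - s))) \<and>
     (\<forall>\<omega>\<in>space M. mono_on {0..} (\<lambda>t. V t \<omega>)) \<and>
     (\<forall>\<omega>\<in>space M. \<forall>t\<ge>0. continuous (at_right t) (\<lambda>s. V s \<omega>)) \<and>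
     (\<forall>t\<ge>0. \<forall>\<xi>>0. (LINT \<omega>|M. exp (- \<xi> * V t \<omega>)) = exp (- t * \<xi> powr \<alpha>))"

text \<open>
  The value 0 is a totalisation on the event that the path is bounded by t, which has
  probability 0 for a stable subordinator; the infimum of the empty set of reals is unspecified.
\<close>

definition inverse_subordinator ::
    "(real \<Rightarrow> 'a \<Rightarrow> real) \<Rightarrow> real \<Rightarrow> 'a \<Rightarrow> real" where
  "inverse_subordinator V t \<omega> =
     (if \<exists>s>0. t < V s \<omega> then Inf {s. 0 < s \<and> t < V s \<omega>} else 0)"

definition process_sigma ::
    "'a measure \<Rightarrow> 'b measure \<Rightarrow> (real \<Rightarrow> 'a \<Rightarrow> 'b) \<Rightarrow> 'a set set" where
  "process_sigma M K X =
     sigma_sets (space M) {X t -` A \<inter> space M | t A. 0 \<le> t \<and> A \<in> sets K}"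

definition indep_processes ::
    "'a measure \<Rightarrow> 'b measure \<Rightarrow> (real \<Rightarrow> 'a \<Rightarrow> 'b) \<Rightarrow> 'c measure \<Rightarrow> (real \<Rightarrow> 'a \<Rightarrow> 'c) \<Rightarrow> bool"
  where
  "indep_processes M K X L Y \<longleftrightarrow>
     prob_space.indep_set M (process_sigma M K X) (process_sigma M L Y)"

end

theory Submission
  imports Defs "HOL-Real_Asymp.Real_Asymp"
begin

text \<open>
  Let A be the generator of the M/M/1 queue. It is bounded, so the system of order \<alpha> has the
  Mittag-Leffler solution: the sum over n of t powr (\<alpha> n) / Gamma (\<alpha> n + 1) times the n-th
  iterate of A applied to the initial distribution. A solution that is bounded on compact time
  intervals, uniformly in k, coincides with it, because fractional integration of order \<alpha>
  turns the system into an integral equation that is a contraction in an exponentially weighted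
  norm. For \<alpha> = 1 the series is the exponential power series for the classical state
  probabilities. By independence, the law of N (E t) is the expectation of that power series at
  E t. Since the n-th moment of E t is fact n * t powr (\<alpha> n) / Gamma (\<alpha> n + 1), this
  expectation is the series of order \<alpha>. The moments are identified by their Laplace
  transforms in t, computed from the events V s \<le> t.
\<close>

section \<open>Fractional integration\<close>

text \<open>The argument uses no density of E t, only its moments. Boundedness of the generator
  makes this possible: its n-th iterate grows at most geometrically in n, uniformly in the state,
  and Gamma (\<alpha> n + 1) outgrows every geometric sequence, so the series converges absolutely
  at all times and may be integrated term by term. Two obstacles shape the rest. Laplace transforms
  alone would identify the moments only for almost every t, so continuity in t has to come from the
  paths: E is continuous because V is almost surely strictly increasing and unbounded. And no joint
  measurability of N is available, so N (E t) is reached through times with countably many values,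
  where independence applies value by value.\<close>

lemma has_bochner_integral_Beta_kernel:
  fixes a b s t :: real
  assumes "0 < a" "0 < b" "s < t"
  shows "has_bochner_integral lborel
    (\<lambda>u. indicator {s<..<t} u * ((t - u) powr (b - 1) * (u - s) powr (a - 1)))
    ((t - s) powr (a + b - 1) * Beta a b)"
proof -
  define c where "c = t - s"
  have c: "c > 0" using assms by (simp add: c_def)
  let ?g = "\<lambda>x::real. indicator {0..1} x *\<^sub>R (x powr (a - 1) * (1 - x) powr (b - 1))"
  have "integrable lborel ?g"
    using integrable_Beta[OF assms(1,2)] by (simp add: set_integrable_def)
  moreover have "integral\<^sup>L lborel ?g = Beta a b"
    using set_borel_integral_eq_integral(2)[OF integrable_Beta[OF assms(1,2)]]
      has_integral_Beta_real[OF assms(1,2)]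
    by (simp add: set_lebesgue_integral_def integral_unique)
  ultimately have "has_bochner_integral lborel ?g (Beta a b)"
    by (simp add: has_bochner_integral_iff)
  \<comment> \<open>Under u = s + c x the two powers contribute c powr (a - 1) and c powr (b - 1);
    the Jacobian supplies the one missing factor c.\<close>
  then have "has_bochner_integral lborel (\<lambda>x. c powr (a + b - 2) * ?g x) (c powr (a + b - 2) * Beta a b)"
    by (intro has_bochner_integral_mult_right) auto
  also have "c powr (a + b - 2) * Beta a b = ((t - s) powr (a + b - 1) * Beta a b) /\<^sub>R \<bar>c\<bar>"
  proof -
    have "c powr (a + b - 1) = c powr (a + b - 2) * c powr 1"
      unfolding powr_add [symmetric] by simp
    then show ?thesis using c by (simp add: c_def [symmetric] field_simps)
  qed
  also have "has_bochner_integral lborel (\<lambda>x. c powr (a + b - 2) * ?g x)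
       (((t - s) powr (a + b - 1) * Beta a b) /\<^sub>R \<bar>c\<bar>) \<longleftrightarrow>
     has_bochner_integral lborel (\<lambda>x. indicator {s<..<t} (s + c * x) *
        ((t - (s + c * x)) powr (b - 1) * (s + c * x - s) powr (a - 1)))
       (((t - s) powr (a + b - 1) * Beta a b) /\<^sub>R \<bar>c\<bar>)"
  proof (rule has_bochner_integral_cong_AE)
    have "AE x in lborel. x \<noteq> (0::real)" "AE x in lborel. x \<noteq> (1::real)"
      by (rule AE_lborel_singleton)+
    then show "AE x in lborel. c powr (a + b - 2) * ?g x = indicator {s<..<t} (s + c * x) *
        ((t - (s + c * x)) powr (b - 1) * (s + c * x - s) powr (a - 1))"
    proof eventually_elim
      case (elim x)
      have [simp]: "t - (s + c * x) = c * (1 - x)" by (simp add: c_def algebra_simps)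
      have "s + c * x < t \<longleftrightarrow> c * x < c * 1" by (auto simp add: c_def)
      then have iff: "s + c * x < t \<longleftrightarrow> x < 1" using c by (simp only: mult_less_cancel_left_pos)
      show ?case
      proof (cases "0 < x \<and> x < 1")
        case True
        then have "(c * (1 - x)) powr (b - 1) = c powr (b - 1) * (1 - x) powr (b - 1)"
          "(c * x) powr (a - 1) = c powr (a - 1) * x powr (a - 1)"
          using c by (simp_all add: powr_mult)
        moreover have "c powr (a + b - 2) = c powr (a - 1) * c powr (b - 1)"
          unfolding powr_add [symmetric] by (simp add: algebra_simps)
        ultimately show ?thesis using True iff c by (simp add: indicator_def)
      next
        case False
        then show ?thesis using elim iff c by (auto simp: indicator_def zero_less_mult_iff)
      qed
    qed
  qed (auto simp: c_def)
  also have "\<dots> \<longleftrightarrow> ?thesis"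
    using c by (subst lborel_has_bochner_integral_real_affine_iff[symmetric]) auto
  finally show ?thesis .
qed

text \<open>The substitution x = s (t - u) turns Euler's Gamma integral into this one. Integrating
  over the whole half-line below t, and not from 0, gives a closed form; it dominates the fractional
  integral of exp (s u) and, with t = 0 and u replaced by -u, is the Laplace transform of a
  power.\<close>

lemma has_bochner_integral_Gamma_kernel:
  fixes a s t :: real
  assumes "0 < a" "0 < s"
  shows "has_bochner_integral lborel
    (\<lambda>u. indicator {..t} u * ((t - u) powr (a - 1) * exp (s * u))) (exp (s * t) * Gamma a / s powr a)"
proof -
  let ?g = "\<lambda>x::real. indicator {0..} x * x powr (a - 1) / exp x"
  have "has_bochner_integral lborel ?g (Gamma a)"
    using Gamma_conv_nn_integral_real[OF assms(1)] assms(1)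
    by (intro has_bochner_integral_nn_integral) (auto simp: Gamma_real_pos less_imp_le)
  then have "has_bochner_integral lborel (\<lambda>u. ?g (s * t + (- s) * u)) (Gamma a /\<^sub>R \<bar>- s\<bar>)"
    using assms by (subst lborel_has_bochner_integral_real_affine_iff[symmetric]) auto
  then have "has_bochner_integral lborel (\<lambda>u. (exp (s * t) / s powr (a - 1)) * ?g (s * t + (- s) * u))
      ((exp (s * t) / s powr (a - 1)) * (Gamma a /\<^sub>R \<bar>- s\<bar>))"
    by (intro has_bochner_integral_mult_right) auto
  moreover have "(exp (s * t) / s powr (a - 1)) * (Gamma a /\<^sub>R \<bar>- s\<bar>) = exp (s * t) * Gamma a / s powr a"
    using assms by (simp add: powr_diff field_simps)
  moreover have "(exp (s * t) / s powr (a - 1)) * ?g (s * t + (- s) * u) =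
      indicator {..t} u * ((t - u) powr (a - 1) * exp (s * u))" for u
  proof -
    have eq: "s * t + (- s) * u = s * (t - u)" by (simp add: algebra_simps)
    have "0 \<le> s * (t - u) \<longleftrightarrow> u \<le> t" using assms by (simp add: zero_le_mult_iff)
    moreover have "exp (s * t) = exp (s * u) * exp (s * (t - u))"
      by (simp add: exp_add [symmetric] algebra_simps)
    moreover have "(s * (t - u)) powr (a - 1) = s powr (a - 1) * (t - u) powr (a - 1)" if "u \<le> t"
      using assms that by (simp add: powr_mult)
    ultimately show ?thesis unfolding eq using assms by (auto simp: indicator_def)
  qed
  ultimately show ?thesis by simp
qed

text \<open>The factor (t - y) powr \<alpha> cancels the kernel and is at most t powr \<alpha> on
  the interval, so integrability passes from the Caputo integrand to the derivative itself.\<close>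

lemma caputo_integrable_deriv:
  assumes "caputo_differentiable \<alpha> f" "0 < \<alpha>" "\<alpha> < 1" "0 < t"
  shows "set_integrable lborel {0<..<t} (deriv f)"
proof -
  let ?h = "\<lambda>y. indicator {0<..<t} y *\<^sub>R ((t - y) powr (- \<alpha>) * deriv f y)"
  have h: "integrable lborel ?h"
    using assms by (auto simp: caputo_differentiable_def set_integrable_def)
  have eq: "indicator {0<..<t} y *\<^sub>R deriv f y = indicator {0<..<t} y * (t - y) powr \<alpha> * ?h y" for y
    by (auto simp: indicator_def powr_minus)
  show ?thesis unfolding set_integrable_def eq
  proof (rule Bochner_Integration.integrable_bound)
    show "integrable lborel (\<lambda>y. t powr \<alpha> * ?h y)" using h by simp
    show "(\<lambda>y. indicator {0<..<t} y * (t - y) powr \<alpha> * ?h y) \<in> borel_measurable lborel"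
      using borel_measurable_integrable[OF h] by (intro borel_measurable_times) auto
    show "AE y in lborel. norm (indicator {0<..<t} y * (t - y) powr \<alpha> * ?h y) \<le> norm (t powr \<alpha> * ?h y)"
      using assms by (intro AE_I2) (auto simp: indicator_def abs_mult intro!: mult_right_mono powr_mono2)
  qed
qed

text \<open>The fundamental theorem for the gauge integral asks for differentiability in the
  interior only, which suits an f that may have no derivative at 0. Absolute integrability of the
  derivative transfers the value to the Lebesgue integral.\<close>

lemma caputo_integral_deriv:
  assumes "caputo_differentiable \<alpha> f" "0 < \<alpha>" "\<alpha> < 1" "0 < t"
  shows "(LBINT y:{0<..<t}. deriv f y) = f t - f 0"
proof -
  have "(deriv f has_integral (f t - f 0)) {0..t}"
  proof (rule fundamental_theorem_of_calculus_interior)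
    show "continuous_on {0..t} f"
      using assms continuous_on_subset[of "{0..}" f "{0..t}"] by (auto simp: caputo_differentiable_def)
    show "(f has_vector_derivative deriv f x) (at x)" if "x \<in> {0<..<t}" for x
      using assms that unfolding has_real_derivative_iff_has_vector_derivative[symmetric]
      by (auto simp: caputo_differentiable_def DERIV_deriv_iff_real_differentiable)
  qed (use assms in auto)
  then have "(deriv f has_integral (f t - f 0)) {0<..<t}" by (simp add: has_integral_Icc_iff_Ioo)
  then show ?thesis
    using set_borel_integral_eq_integral(2)[OF caputo_integrable_deriv[OF assms]]
    by (simp add: integral_unique)
qed

text \<open>Abel's inversion: after the order of integration is exchanged, the integral of
  \<open>(t - u) powr (\<alpha> - 1) * (u - y) powr (- \<alpha>)\<close> over u between y and t is
  the constant \<open>Gamma \<alpha> * Gamma (1 - \<alpha>)\<close>, and what remains is the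
  integral of the derivative of f.\<close>

lemma fractional_integral_caputo_deriv:
  assumes f: "caputo_differentiable \<alpha> f" and \<alpha>: "0 < \<alpha>" "\<alpha> < 1" and t: "0 < t"
  shows "set_integrable lborel {0<..<t} (\<lambda>u. (t - u) powr (\<alpha> - 1) * caputo_deriv \<alpha> f u)" (is ?int)
    and "(LBINT u:{0<..<t}. (t - u) powr (\<alpha> - 1) * caputo_deriv \<alpha> f u) = Gamma \<alpha> * (f t - f 0)" (is ?val)
proof -
  define g where "g = (\<lambda>y. indicator {0<..<t} y * deriv f y)"
  have g: "integrable lborel g"
    using caputo_integrable_deriv[OF assms] by (simp add: set_integrable_def g_def)
  then have [measurable]: "g \<in> borel_measurable borel" by auto
  let ?K = "\<lambda>y u. indicator {y<..<t} u * ((t - u) powr (\<alpha> - 1) * (u - y) powr ((1 - \<alpha>) - 1))"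
  define F where "F = (\<lambda>y u. ?K y u * g y)"
  have ind: "indicator {y<..<t} u = (if y < u \<and> u < t then 1 else (0::real))" for y u
    by (auto simp: indicator_def)
  have F_meas: "case_prod F \<in> borel_measurable (lborel \<Otimes>\<^sub>M lborel)"
    unfolding F_def case_prod_unfold ind by measurable
  have K: "has_bochner_integral lborel (?K y) (Beta (1 - \<alpha>) \<alpha>)" if "y < t" for y
    using has_bochner_integral_Beta_kernel[of "1 - \<alpha>" \<alpha> y t] \<alpha> that by simp
  have g0: "g y = 0" if "\<not> y < t" for y using that by (simp add: g_def)
  have B: "Beta (1 - \<alpha>) \<alpha> = Gamma \<alpha> * Gamma (1 - \<alpha>)" by (simp add: Beta_def)
  have F_int: "integrable lborel (F y)" for y
    using K[of y] g0[of y] by (cases "y < t") (auto simp: F_def has_bochner_integral_iff)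
  have F_val: "integral\<^sup>L lborel (F y) = Beta (1 - \<alpha>) \<alpha> * g y" for y
    using K[of y] g0[of y] by (cases "y < t") (auto simp: F_def has_bochner_integral_iff)
  \<comment> \<open>The kernel is nonnegative, so the absolute value falls on \<open>g\<close>
    alone; with the integrability of \<open>g\<close> this gives the hypothesis of Fubini's
    theorem.\<close>
  have F_abs: "(LINT u|lborel. norm (F y u)) = Beta (1 - \<alpha>) \<alpha> * \<bar>g y\<bar>" for y
  proof (cases "y < t")
    case True
    have "norm (F y u) = ?K y u * \<bar>g y\<bar>" for u by (simp add: F_def abs_mult)
    then show ?thesis using K[OF True] by (simp add: has_bochner_integral_iff)
  qed (simp add: F_def g0)
  have F2: "integrable (lborel \<Otimes>\<^sub>M lborel) (case_prod F)"
    using g F_int by (intro lborel_pair.Fubini_integrable[OF F_meas]) (simp_all add: F_abs del: real_norm_def)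
  have "(LINT u|lborel. LINT y|lborel. F y u) = (LINT y|lborel. LINT u|lborel. F y u)"
    using F2 by (rule lborel_pair.Fubini_integral)
  also have "\<dots> = Beta (1 - \<alpha>) \<alpha> * (f t - f 0)"
    using caputo_integral_deriv[OF assms] by (simp add: F_val g_def set_lebesgue_integral_def)
  also have inner: "(\<lambda>u. LINT y|lborel. F y u) =
      (\<lambda>u. Gamma (1 - \<alpha>) * (indicator {0<..<t} u *\<^sub>R ((t - u) powr (\<alpha> - 1) * caputo_deriv \<alpha> f u)))"
  proof
    fix u
    show "(LINT y|lborel. F y u) =
      Gamma (1 - \<alpha>) * (indicator {0<..<t} u *\<^sub>R ((t - u) powr (\<alpha> - 1) * caputo_deriv \<alpha> f u))"
    proof (cases "u \<in> {0<..<t}")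
      case True
      \<comment> \<open>For fixed u the two indicators combine to the range 0 < y < u, where the
        Caputo integrand at time u appears.\<close>
      have "F y u = (t - u) powr (\<alpha> - 1) * (indicator {0<..<u} y *\<^sub>R ((u - y) powr (- \<alpha>) * deriv f y))" for y
        using True by (auto simp: F_def g_def indicator_def)
      moreover have "Gamma (1 - \<alpha>) \<noteq> 0"
        by (rule less_imp_neq[symmetric], rule Gamma_real_pos) (use \<alpha> in simp)
      ultimately show ?thesis using True \<alpha>
        by (simp add: caputo_deriv_def set_lebesgue_integral_def)
    next
      case False
      then have "F y u = 0" for y by (auto simp: F_def g_def indicator_def)
      then show ?thesis using False by simp
    qed
  qed
  finally have "Gamma (1 - \<alpha>) * (LBINT u:{0<..<t}. (t - u) powr (\<alpha> - 1) * caputo_deriv \<alpha> f u) =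
      Gamma (1 - \<alpha>) * (Gamma \<alpha> * (f t - f 0))"
    by (simp add: set_lebesgue_integral_def B)
  moreover have \<Gamma>: "Gamma (1 - \<alpha>) \<noteq> 0"
    by (rule less_imp_neq[symmetric], rule Gamma_real_pos) (use \<alpha> in simp)
  ultimately show ?val by simp
  have "integrable lborel (\<lambda>u. LINT y|lborel. F y u)"
    using F2 by (rule lborel_pair.integrable_snd)
  then show ?int
    using \<Gamma> by (simp add: inner set_integrable_def integrable_mult_right_iff)
qed

text \<open>For \<alpha> < 1, \<open>Gamma \<alpha> * f t\<close> is the integral of the Caputo
  derivative against the kernel, and extending the majorant from (0, t) to all u \<le> t only
  increases it and makes its integral explicit. The gain s powr (- \<alpha>) is what the contraction
  argument consumes.\<close>

lemma caputo_exp_bound: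
  assumes f: "caputo_differentiable \<alpha> f" and \<alpha>: "0 < \<alpha>" "\<alpha> \<le> 1" and s: "0 < s"
    and f0: "f 0 = 0" and t: "0 < t"
    and bound: "\<And>u. 0 < u \<Longrightarrow> u \<le> t \<Longrightarrow> \<bar>caputo_deriv \<alpha> f u\<bar> \<le> B * exp (s * u)"
  shows "\<bar>f t\<bar> \<le> B / s powr \<alpha> * exp (s * t)"
proof -
  have B: "0 \<le> B" using bound[of t] t by (smt (verit) exp_gt_zero mult_neg_pos)
  show ?thesis
  proof (cases "\<alpha> = 1")
    case True
    have cont: "continuous_on {0..t} f"
      using f continuous_on_subset[of "{0..}" f "{0..t}"] by (auto simp: caputo_differentiable_def)
    have der: "(f has_real_derivative deriv f u) (at u)" if "0 < u" for u
      using f that by (auto simp: caputo_differentiable_def DERIV_deriv_iff_real_differentiable)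
    have bd: "\<bar>deriv f u\<bar> \<le> B * exp (s * u)" if "0 < u" "u < t" for u
      using bound[of u] that True by (simp add: caputo_deriv_def)
    \<comment> \<open>Both signs at once: c = 1 and c = -1 give the lower and the upper bound for
      \<open>f t\<close>, because the comparison function has the nonnegative derivative
      \<open>B * exp (s * u) + c * deriv f u\<close>.\<close>
    have *: "B / s * exp (s * 0) + c * f 0 \<le> B / s * exp (s * t) + c * f t" if "\<bar>c\<bar> = 1" for c
    proof (rule DERIV_nonneg_imp_increasing_open[where f = "\<lambda>u. B / s * exp (s * u) + c * f u"])
      show "continuous_on {0..t} (\<lambda>u. B / s * exp (s * u) + c * f u)"
        by (intro continuous_intros cont)
      show "\<exists>y. ((\<lambda>u. B / s * exp (s * u) + c * f u) has_real_derivative y) (at u) \<and> 0 \<le> y"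
        if "0 < u" "u < t" for u
      proof (intro exI conjI)
        show "((\<lambda>u. B / s * exp (s * u) + c * f u) has_real_derivative B * exp (s * u) + c * deriv f u) (at u)"
          using s by (auto intro!: derivative_eq_intros der that)
        show "0 \<le> B * exp (s * u) + c * deriv f u"
          using bd[OF that] \<open>\<bar>c\<bar> = 1\<close> by (auto simp: abs_if split: if_splits)
      qed
    qed (use t in auto)
    have "0 \<le> B / s" using B s by simp
    then show ?thesis using *[of 1] *[of "-1"] f0 True s by simp
  next
    case False
    with \<alpha> have \<alpha>: "0 < \<alpha>" "\<alpha> < 1" by auto
    let ?h = "\<lambda>u. indicator {..t} u * ((t - u) powr (\<alpha> - 1) * exp (s * u))"
    have h: "has_bochner_integral lborel ?h (exp (s * t) * Gamma \<alpha> / s powr \<alpha>)"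
      using has_bochner_integral_Gamma_kernel \<alpha> s by blast
    have "Gamma \<alpha> * \<bar>f t\<bar> = \<bar>LBINT u:{0<..<t}. (t - u) powr (\<alpha> - 1) * caputo_deriv \<alpha> f u\<bar>"
      using fractional_integral_caputo_deriv(2)[OF f \<alpha> t] f0 Gamma_real_pos[of \<alpha>] \<alpha> by (simp add: abs_mult)
    also have "\<dots> \<le> (LINT u|lborel. B * ?h u)"
      unfolding set_lebesgue_integral_def
    proof (rule integral_abs_bound_integral)
      show "\<bar>indicator {0<..<t} u *\<^sub>R ((t - u) powr (\<alpha> - 1) * caputo_deriv \<alpha> f u)\<bar> \<le> B * ?h u" for u
        using bound[of u] B by (auto simp: indicator_def abs_mult algebra_simps intro!: mult_left_mono)
      show "integrable lborel (\<lambda>u. B * ?h u)" using h by (simp add: has_bochner_integral_iff)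
      show "integrable lborel (\<lambda>u. indicator {0<..<t} u *\<^sub>R ((t - u) powr (\<alpha> - 1) * caputo_deriv \<alpha> f u))"
        using fractional_integral_caputo_deriv(1)[OF f \<alpha> t] by (simp add: set_integrable_def)
    qed
    also have "\<dots> = Gamma \<alpha> * (B / s powr \<alpha> * exp (s * t))"
      using h by (simp add: has_bochner_integral_iff)
    finally show ?thesis by (rule mult_left_le_imp_le) (rule Gamma_real_pos[OF \<alpha>(1)])
  qed
qed

section \<open>The fractional M/M/1 system\<close>

text \<open>The right-hand side of the Kolmogorov forward equations as an operator on sequences.
  State 0 needs its own clause because on the naturals k - 1 is 0 at k = 0.\<close>

definition MM1_generator :: "real \<Rightarrow> real \<Rightarrow> (nat \<Rightarrow> real) \<Rightarrow> nat \<Rightarrow> real" where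
  "MM1_generator lam \<mu> x k =
     (if k = 0 then - lam * x 0 + \<mu> * x 1
      else - (lam + \<mu>) * x k + lam * x (k - 1) + \<mu> * x (k + 1))"

text \<open>The coefficients in one equation have absolute values adding up to at most 2 * (lam +
  \<mu>). This norm bound is the source of the constants in the uniqueness proof and in the growth
  of \<open>MM1_coeff\<close>.\<close>

lemma MM1_generator_bound:
  assumes "0 < lam" "0 < \<mu>" "\<And>k. \<bar>x k\<bar> \<le> K"
  shows "\<bar>MM1_generator lam \<mu> x k\<bar> \<le> 2 * (lam + \<mu>) * K"
proof -
  have K: "0 \<le> K" using assms(3)[of 0] by linarith
  have b: "\<bar>c * x j\<bar> \<le> \<bar>c\<bar> * K" for c j
    using assms(3)[of j] by (simp add: abs_mult mult_left_mono)
  have "\<bar>- lam * x 0 + \<mu> * x 1\<bar> \<le> lam * K + \<mu> * K"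
    using b[of "- lam" 0] b[of \<mu> 1] assms(1,2) by linarith
  moreover have "\<bar>- (lam + \<mu>) * x k + lam * x (k - 1) + \<mu> * x (k + 1)\<bar> \<le> (lam + \<mu>) * K + lam * K + \<mu> * K"
    using b[of "- (lam + \<mu>)" k] b[of lam "k - 1"] b[of \<mu> "k + 1"] assms(1,2) by linarith
  moreover have "0 \<le> lam * K" "0 \<le> \<mu> * K" using assms K by auto
  ultimately show ?thesis unfolding MM1_generator_def by (auto simp: algebra_simps)
qed

lemma MM1_generator_diff:
  "MM1_generator lam \<mu> (\<lambda>k. x k - y k) k = MM1_generator lam \<mu> x k - MM1_generator lam \<mu> y k"
  by (simp add: MM1_generator_def algebra_simps)

lemma MM1_generator_mult_right:
  "MM1_generator lam \<mu> (\<lambda>k. x k * c) k = MM1_generator lam \<mu> x k * c"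
  by (simp add: MM1_generator_def algebra_simps)

text \<open>The derivative of the difference splits at positive times, which suffices because the
  Caputo integral runs over an open interval.\<close>

lemma caputo_diff:
  assumes f: "caputo_differentiable \<alpha> f" and g: "caputo_differentiable \<alpha> g" and "\<alpha> \<le> 1"
  shows "caputo_differentiable \<alpha> (\<lambda>t. f t - g t)"
    and "0 < t \<Longrightarrow> caputo_deriv \<alpha> (\<lambda>t. f t - g t) t = caputo_deriv \<alpha> f t - caputo_deriv \<alpha> g t"
proof -
  have d: "deriv (\<lambda>t. f t - g t) t = deriv f t - deriv g t" if "0 < t" for t
    using f g that unfolding caputo_differentiable_def
    by (intro DERIV_imp_deriv DERIV_diff) (auto simp: DERIV_deriv_iff_real_differentiable)
  have eq: "indicator {0<..<t} y *\<^sub>R ((t - y) powr - \<alpha> * deriv (\<lambda>t. f t - g t) y) =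
      indicator {0<..<t} y *\<^sub>R ((t - y) powr - \<alpha> * deriv f y) -
      indicator {0<..<t} y *\<^sub>R ((t - y) powr - \<alpha> * deriv g y)" for t y
    by (auto simp: indicator_def d algebra_simps)
  show "caputo_differentiable \<alpha> (\<lambda>t. f t - g t)"
    using f g unfolding caputo_differentiable_def set_integrable_def eq
    by (auto intro!: continuous_intros)
  show "caputo_deriv \<alpha> (\<lambda>t. f t - g t) t = caputo_deriv \<alpha> f t - caputo_deriv \<alpha> g t" if "0 < t"
    using f g that \<open>\<alpha> \<le> 1\<close> d[OF that]
    unfolding caputo_deriv_def caputo_differentiable_def set_integrable_def set_lebesgue_integral_def eq
    by (auto simp: Bochner_Integration.integral_diff right_diff_distrib)
qed

text \<open>
  In the weighted norm with weight exp (- s t), the fractional integral of order \<alpha> has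
  norm at most s powr (- \<alpha>), so for large s the integrated system is a contraction.
\<close>

lemma fractional_MM1_unique:
  assumes \<alpha>: "0 < \<alpha>" "\<alpha> \<le> 1" and rates: "0 < lam" "0 < \<mu>"
    and x: "\<And>k. caputo_differentiable \<alpha> (x k)"
      "\<And>k t. 0 < t \<Longrightarrow> caputo_deriv \<alpha> (x k) t = MM1_generator lam \<mu> (\<lambda>k. x k t) k"
    and y: "\<And>k. caputo_differentiable \<alpha> (y k)"
      "\<And>k t. 0 < t \<Longrightarrow> caputo_deriv \<alpha> (y k) t = MM1_generator lam \<mu> (\<lambda>k. y k t) k"
    and init: "\<And>k. x k 0 = y k 0"
    and bound: "\<And>k t. 0 \<le> t \<Longrightarrow> t \<le> T \<Longrightarrow> \<bar>x k t\<bar> \<le> K" "\<And>k t. 0 \<le> t \<Longrightarrow> t \<le> T \<Longrightarrow> \<bar>y k t\<bar> \<le> L"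
    and t: "0 \<le> t" "t \<le> T"
  shows "x k t = y k t"
proof -
  define c where "c = 2 * (lam + \<mu>)"
  \<comment> \<open>With c bounding the norm of the generator, this makes s powr \<alpha> = 2 * c,
    so each pass through the integral equation contributes the factor c / s powr \<alpha> =
    1/2.\<close>
  define s where "s = (2 * c) powr (1 / \<alpha>)"
  have c: "0 < c" using rates by (simp add: c_def)
  then have s: "0 < s" by (simp add: s_def)
  have s\<alpha>: "s powr \<alpha> = 2 * c" using c \<alpha> by (simp add: s_def powr_powr)
  \<comment> \<open>The start n = 0 uses the bounds uniform in k. The induction generalises over k
    and t because the generator links neighbouring states and the estimate is needed at all earlier
    times.\<close>
  have iter: "\<bar>x k t - y k t\<bar> \<le> (K + L) * (1/2) ^ n * exp (s * t)" if "0 \<le> t" "t \<le> T" for k t n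
    using that
  proof (induction n arbitrary: k t)
    case 0
    have "\<bar>x k t - y k t\<bar> \<le> K + L" using bound[OF 0, of k] by linarith
    moreover have "0 \<le> K + L" using bound[OF 0, of 0] by linarith
    moreover have "1 \<le> exp (s * t)" using s 0 by simp
    ultimately show ?case using mult_left_mono[of 1 "exp (s * t)" "K + L"] by simp
  next
    case (Suc n)
    have KL: "0 \<le> K + L" using bound[OF Suc.prems, of 0] by linarith
    show ?case
    proof (cases "t = 0")
      case True
      then show ?thesis using init[of k] KL by simp
    next
      case False
      let ?B = "c * ((K + L) * (1/2) ^ n)"
      have "\<bar>x k t - y k t\<bar> \<le> ?B / s powr \<alpha> * exp (s * t)"
      proof (rule caputo_exp_bound)
        show "caputo_differentiable \<alpha> (\<lambda>t. x k t - y k t)"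
          by (rule caputo_diff(1)[OF x(1) y(1) \<alpha>(2)])
        fix u assume u: "0 < u" "u \<le> t"
        have "\<bar>MM1_generator lam \<mu> (\<lambda>k. x k u - y k u) k\<bar> \<le>
            2 * (lam + \<mu>) * ((K + L) * (1/2) ^ n * exp (s * u))"
          using Suc.IH[of u] u Suc.prems by (intro MM1_generator_bound rates) auto
        then show "\<bar>caputo_deriv \<alpha> (\<lambda>t. x k t - y k t) u\<bar> \<le> ?B * exp (s * u)"
          using u by (simp add: caputo_diff(2)[OF x(1) y(1) \<alpha>(2)] x(2) y(2) MM1_generator_diff c_def mult.assoc)
      qed (use \<alpha> s init False Suc.prems in auto)
      also have "\<dots> = (K + L) * (1/2) ^ Suc n * exp (s * t)"
        using c by (simp add: s\<alpha>)
      finally show ?thesis .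
    qed
  qed
  have "(\<lambda>n. (K + L) * (1/2) ^ n * exp (s * t)) \<longlonglongrightarrow> (K + L) * 0 * exp (s * t)"
    by (intro tendsto_intros LIMSEQ_realpow_zero) auto
  then have "\<bar>x k t - y k t\<bar> \<le> (K + L) * 0 * exp (s * t)"
    by (rule LIMSEQ_le_const) (use iter t in auto)
  then show ?thesis by simp
qed

section \<open>Mittag-Leffler series with general coefficients\<close>

text \<open>With c n = z ^ n this is the Mittag-Leffler function of z * t powr \<alpha>. Writing
  \<open>(t powr \<alpha>) ^ n\<close> and not \<open>t powr (\<alpha> * n)\<close> gives the
  constant term its correct value at t = 0, where 0 powr 0 = 0 but 0 ^ 0 = 1, and exhibits a power
  series composed with a power.\<close>

definition ml_series :: "real \<Rightarrow> (nat \<Rightarrow> real) \<Rightarrow> real \<Rightarrow> real" where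
  "ml_series \<alpha> c t = (\<Sum>n. c n / Gamma (\<alpha> * real n + 1) * (t powr \<alpha>) ^ n)"

text \<open>Cut the Gamma integral down to t \<ge> R and use t powr x \<ge> R powr x there. The
  parameter R is free, and this elementary bound does the work of Stirling's formula.\<close>

lemma Gamma_plus1_ge:
  fixes x R :: real
  assumes "0 \<le> x" "0 \<le> R"
  shows "R powr x * exp (- R) \<le> Gamma (x + 1)"
proof -
  have "(\<integral>\<^sup>+t. ennreal (R powr x * exp (- t)) * indicator {R..} t \<partial>lborel) = ennreal (0 - (- (R powr x * exp (- R))))"
  proof (rule nn_integral_FTC_atLeast[where F = "\<lambda>t. - (R powr x * exp (- t))"])
    show "((\<lambda>t. - (R powr x * exp (- t))) has_real_derivative R powr x * exp (- t)) (at t)" for t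
      by (auto intro!: derivative_eq_intros)
    have "((\<lambda>t. - (R powr x * exp (- t))) \<longlongrightarrow> - (R powr x * 0)) at_top"
      by (intro tendsto_intros filterlim_compose[OF exp_at_bot] filterlim_uminus_at_bot_at_top)
    then show "((\<lambda>t. - (R powr x * exp (- t))) \<longlongrightarrow> 0) at_top" by simp
  qed auto
  moreover have "(\<integral>\<^sup>+t. ennreal (R powr x * exp (- t)) * indicator {R..} t \<partial>lborel) \<le>
      (\<integral>\<^sup>+t. ennreal (indicator {0..} t * t powr (x + 1 - 1) / exp t) \<partial>lborel)"
    using assms
    by (intro nn_integral_mono) (auto simp: indicator_def exp_minus field_simps intro!: ennreal_leI powr_mono2 mult_right_mono divide_right_mono)
  moreover have "\<dots> = ennreal (Gamma (x + 1))"
    using assms by (subst Gamma_conv_nn_integral_real) auto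
  ultimately have "ennreal (R powr x * exp (- R)) \<le> ennreal (Gamma (x + 1))" by simp
  then show ?thesis using assms by (subst (asm) ennreal_le_iff) (auto intro: less_imp_le Gamma_real_pos)
qed

text \<open>The n-th power of |z| is at most (1/2) ^ n * R powr (\<alpha> n), and the last factor is
  absorbed by Gamma at the price of exp R.\<close>

lemma ml_term_bound:
  fixes \<alpha> z R :: real
  assumes "0 < \<alpha>" "0 < R" "2 * \<bar>z\<bar> \<le> R powr \<alpha>"
  shows "\<bar>z ^ n / Gamma (\<alpha> * real n + 1)\<bar> \<le> exp R * (1/2) ^ n"
proof -
  have pos: "0 < Gamma (\<alpha> * real n + 1)" using assms by (intro Gamma_real_pos add_nonneg_pos) auto
  have "\<bar>z\<bar> ^ n \<le> (R powr \<alpha> / 2) ^ n" using assms by (intro power_mono) auto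
  also have "\<dots> = (1/2) ^ n * R powr (\<alpha> * real n)"
    using assms by (simp add: power_divide powr_powr [symmetric] powr_realpow)
  also have "\<dots> = exp R * (1/2) ^ n * (R powr (\<alpha> * real n) * exp (- R))"
    by (simp add: exp_minus)
  also have "\<dots> \<le> exp R * (1/2) ^ n * Gamma (\<alpha> * real n + 1)"
    using assms by (intro mult_left_mono Gamma_plus1_ge) auto
  finally show ?thesis using pos by (simp add: power_abs [symmetric] abs_mult divide_le_eq)
qed

lemma ml_summable:
  assumes "0 < \<alpha>" "\<And>n. \<bar>c n\<bar> \<le> C ^ n"
  shows "summable (\<lambda>n. \<bar>c n\<bar> / Gamma (\<alpha> * real n + 1) * \<bar>z\<bar> ^ n)"
proof -
  have C: "0 \<le> C" using assms(2)[of 1] by simp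
  have z: "0 < 2 * C * \<bar>z\<bar> + 1" using C by (intro add_nonneg_pos) auto
  \<comment> \<open>Chosen so that 2 * (C * |z|) \<le> R powr \<alpha>; the added 1 keeps the base
    positive when C * z vanishes.\<close>
  define R where "R = (2 * C * \<bar>z\<bar> + 1) powr (1 / \<alpha>)"
  have R: "0 < R" "R powr \<alpha> = 2 * C * \<bar>z\<bar> + 1"
    using assms z by (simp_all add: R_def powr_powr)
  have pos: "0 < Gamma (\<alpha> * real n + 1)" for n using assms by (intro Gamma_real_pos add_nonneg_pos) auto
  show ?thesis
  proof (rule summable_comparison_test')
    show "summable (\<lambda>n. exp R * (1/2) ^ n :: real)" by (intro summable_mult summable_geometric) auto
    show "norm (\<bar>c n\<bar> / Gamma (\<alpha> * real n + 1) * \<bar>z\<bar> ^ n) \<le> exp R * (1/2) ^ n" for n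
    proof -
      have "\<bar>c n\<bar> / Gamma (\<alpha> * real n + 1) * \<bar>z\<bar> ^ n \<le> C ^ n / Gamma (\<alpha> * real n + 1) * \<bar>z\<bar> ^ n"
        using assms(2) pos[of n] by (intro mult_right_mono divide_right_mono) auto
      also have "\<dots> \<le> \<bar>(C * \<bar>z\<bar>) ^ n / Gamma (\<alpha> * real n + 1)\<bar>"
        using pos[of n] C by (simp add: power_mult_distrib abs_mult)
      also have "\<dots> \<le> exp R * (1/2) ^ n"
        using assms C R by (intro ml_term_bound) (auto simp: abs_mult)
      finally show ?thesis using pos[of n] by simp
    qed
  qed
qed

text \<open>The majorant, the series with coefficients C ^ n at time T, does not involve c. For the
  coefficients of all states at once it gives the bound uniform in k that uniqueness asks
  for.\<close>

lemma ml_series_bounded: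
  assumes "0 < \<alpha>" "0 \<le> C"
  obtains K where "\<And>c t. (\<And>n. \<bar>c n\<bar> \<le> C ^ n) \<Longrightarrow> 0 \<le> t \<Longrightarrow> t \<le> T \<Longrightarrow> \<bar>ml_series \<alpha> c t\<bar> \<le> K"
proof
  fix c t assume c: "\<And>n. \<bar>c n\<bar> \<le> C ^ n" and t: "0 \<le> t" "t \<le> T"
  let ?a = "\<lambda>c z n. c n / Gamma (\<alpha> * real n + 1) * z ^ n"
  have pos: "0 < Gamma (\<alpha> * real n + 1)" for n using assms by (intro Gamma_real_pos add_nonneg_pos) auto
  have s1: "summable (?a (\<lambda>n. \<bar>c n\<bar>) (t powr \<alpha>))"
    using ml_summable[OF assms(1) c, of "t powr \<alpha>"] by simp
  have s2: "summable (?a (\<lambda>n. C ^ n) (T powr \<alpha>))"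
    using ml_summable[OF assms(1), of "\<lambda>n. C ^ n" C "T powr \<alpha>"] assms by simp
  have abs: "\<bar>?a c (t powr \<alpha>) n\<bar> = ?a (\<lambda>n. \<bar>c n\<bar>) (t powr \<alpha>) n" for n
    using pos[of n] by (simp add: abs_mult)
  have "\<bar>ml_series \<alpha> c t\<bar> \<le> (\<Sum>n. ?a (\<lambda>n. \<bar>c n\<bar>) (t powr \<alpha>) n)"
    unfolding ml_series_def using summable_rabs[of "?a c (t powr \<alpha>)"] s1 by (simp only: abs)
  also have "\<dots> \<le> (\<Sum>n. ?a (\<lambda>n. C ^ n) (T powr \<alpha>) n)"
    using s1 s2 c pos t assms
    by (intro suminf_le mult_mono divide_right_mono power_mono powr_mono2)
       (auto intro: less_imp_le divide_nonneg_nonneg less_imp_le[OF pos])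
  finally show "\<bar>ml_series \<alpha> c t\<bar> \<le> (\<Sum>n. ?a (\<lambda>n. C ^ n) (T powr \<alpha>) n)" .
qed

lemma ml_series_0 [simp]: "ml_series \<alpha> c 0 = c 0"
proof -
  have "(\<lambda>n. c n / Gamma (\<alpha> * real n + 1) * (0 powr \<alpha>) ^ n) = (\<lambda>n. if n = 0 then c 0 else 0)"
    by (auto simp: fun_eq_iff)
  then show ?thesis using sums_unique[OF sums_single[of 0 "\<lambda>_. c 0"]] by (simp add: ml_series_def)
qed

text \<open>For \<alpha> < 1 the Beta kernel sends y powr (\<alpha> (n + 1) - 1) / Gamma (\<alpha>
  (n + 1)) to Gamma (1 - \<alpha>) times t powr (\<alpha> n) / Gamma (\<alpha> n + 1), so the Caputo
  derivative acts as a shift of the coefficients. Working term by term is legitimate because the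
  series of L1 norms converges.\<close>

lemma ml_series_caputo:
  assumes \<alpha>: "0 < \<alpha>" "\<alpha> \<le> 1" and c: "\<And>n. \<bar>c n\<bar> \<le> C ^ n"
  shows "caputo_differentiable \<alpha> (ml_series \<alpha> c)"
    and "0 < t \<Longrightarrow> caputo_deriv \<alpha> (ml_series \<alpha> c) t = ml_series \<alpha> (\<lambda>n. c (Suc n)) t"
proof -
  define a where "a = (\<lambda>n. c n / Gamma (\<alpha> * real n + 1))"
  define F where "F = (\<lambda>z. \<Sum>n. a n * z ^ n)"
  \<comment> \<open>\<open>d n\<close> is the derivative of the term of index n + 1; the constant
    term disappears, which is the origin of the shift.\<close>
  define d where "d = (\<lambda>n y. c (Suc n) / Gamma (\<alpha> * real (Suc n)) * y powr (\<alpha> * real (Suc n) - 1))"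
  have pos: "0 < Gamma (\<alpha> * real n + 1)" for n using \<alpha> by (intro Gamma_real_pos add_nonneg_pos) auto
  have pos': "0 < Gamma (\<alpha> * real (Suc n))" for n using \<alpha> by (intro Gamma_real_pos) auto
  have S: "ml_series \<alpha> c = (\<lambda>t. F (t powr \<alpha>))"
    by (simp add: ml_series_def F_def a_def fun_eq_iff)
  have summ_abs: "summable (\<lambda>n. \<bar>a n\<bar> * z ^ n)" for z
  proof (rule summable_rabs_cancel)
    have "\<bar>\<bar>a n\<bar> * z ^ n\<bar> = \<bar>c n\<bar> / Gamma (\<alpha> * real n + 1) * \<bar>z\<bar> ^ n" for n
      using pos[of n] by (simp add: a_def abs_mult power_abs)
    then show "summable (\<lambda>n. \<bar>\<bar>a n\<bar> * z ^ n\<bar>)"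
      using ml_summable[OF \<alpha>(1) c, of z] by simp
  qed
  have summ: "summable (\<lambda>n. a n * z ^ n)" for z
  proof (rule summable_rabs_cancel)
    show "summable (\<lambda>n. \<bar>a n * z ^ n\<bar>)"
      using summ_abs[of "\<bar>z\<bar>"] by (simp add: abs_mult power_abs)
  qed
  have F: "(F has_real_derivative (\<Sum>n. diffs a n * z ^ n)) (at z)" for z
    unfolding F_def by (rule termdiffs_strong_converges_everywhere[OF summ])
  have diffs_eq: "diffs a n = c (Suc n) / (\<alpha> * Gamma (\<alpha> * real (Suc n)))" for n
  proof -
    have "Gamma (\<alpha> * real (Suc n) + 1) = \<alpha> * real (Suc n) * Gamma (\<alpha> * real (Suc n))"
      using \<alpha> by (intro Gamma_plus1) (auto dest!: nonpos_Ints_nonpos simp: mult_le_0_iff)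
    then show ?thesis by (simp add: diffs_def a_def field_simps del: of_nat_Suc)
  qed
  have d_eq: "diffs a n * (y powr \<alpha>) ^ n * (\<alpha> * y powr (\<alpha> - 1)) = d n y" if "0 < y" for n y
  proof -
    have "(y powr \<alpha>) ^ n * y powr (\<alpha> - 1) = y powr (\<alpha> * real (Suc n) - 1)"
      using that by (simp add: powr_realpow[symmetric] powr_powr powr_add[symmetric] algebra_simps)
    then show ?thesis unfolding d_def diffs_eq using \<alpha> by (simp add: field_simps del: of_nat_Suc)
  qed
  \<comment> \<open>Passing to the coefficients \<open>\<bar>a n\<bar>\<close> makes the terms of
    the differentiated series nonnegative, so plain summability becomes absolute
    summability.\<close>
  have d_abs: "diffs (\<lambda>n. \<bar>a n\<bar>) n * (y powr \<alpha>) ^ n * (\<alpha> * y powr (\<alpha> - 1)) = \<bar>d n y\<bar>" if "0 < y" for n y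
    unfolding d_eq[OF that, symmetric] using \<alpha> by (simp add: diffs_def abs_mult)
  have d_summ: "summable (\<lambda>n. \<bar>d n y\<bar>)" if "0 < y" for y
    unfolding d_abs[OF that, symmetric] by (intro summable_mult2 termdiff_converges_all summ_abs)
  have der: "(ml_series \<alpha> c has_real_derivative (\<Sum>n. d n y)) (at y)" if "0 < y" for y
  proof -
    have "((\<lambda>t. F (t powr \<alpha>)) has_real_derivative
        (\<Sum>n. diffs a n * (y powr \<alpha>) ^ n) * (\<alpha> * y powr (\<alpha> - 1))) (at y)"
      using that by (intro DERIV_chain2[OF F] has_real_derivative_powr)
    also have "(\<Sum>n. diffs a n * (y powr \<alpha>) ^ n) * (\<alpha> * y powr (\<alpha> - 1)) = (\<Sum>n. d n y)"
      unfolding d_eq[OF that, symmetric] by (intro suminf_mult2 termdiff_converges_all summ)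
    finally show ?thesis by (simp add: S)
  qed
  have deriv: "deriv (ml_series \<alpha> c) y = (\<Sum>n. d n y)" if "0 < y" for y
    using der[OF that] by (rule DERIV_imp_deriv)
  have cont: "continuous_on {0..} (ml_series \<alpha> c)"
  proof -
    have powr: "continuous_on {0..} (\<lambda>t::real. t powr \<alpha>)"
      using \<alpha> by (intro continuous_on_powr') (auto intro!: continuous_intros)
    have "continuous_on UNIV F"
      using F by (intro DERIV_continuous_on) auto
    then show ?thesis unfolding S by (rule continuous_on_compose2[OF _ powr subset_UNIV])
  qed
  have kernel: "set_integrable lborel {0<..<t} (\<lambda>y. (t - y) powr (- \<alpha>) * deriv (ml_series \<alpha> c) y) \<and>
      (LBINT y:{0<..<t}. (t - y) powr (- \<alpha>) * deriv (ml_series \<alpha> c) y) =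
      Gamma (1 - \<alpha>) * ml_series \<alpha> (\<lambda>n. c (Suc n)) t" if t: "0 < t" and "\<alpha> < 1" for t
  proof -
    define h where "h = (\<lambda>n y. indicator {0<..<t} y * ((t - y) powr (- \<alpha>) * d n y))"
    have \<Gamma>: "0 < Gamma (1 - \<alpha>)" using \<open>\<alpha> < 1\<close> by (intro Gamma_real_pos) auto
    \<comment> \<open>Stated for an arbitrary factor q because it is needed for
      \<open>c (Suc n)\<close> and, to control the L1 norms, for its absolute value.\<close>
    have hb: "has_bochner_integral lborel
        (\<lambda>y. indicator {0<..<t} y * ((t - y) powr (- \<alpha>) * (q / Gamma (\<alpha> * real (Suc n)) * y powr (\<alpha> * real (Suc n) - 1))))
        (Gamma (1 - \<alpha>) * (q / Gamma (\<alpha> * real n + 1) * (t powr \<alpha>) ^ n))" for q n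
    proof -
      have "has_bochner_integral lborel
          (\<lambda>y. q / Gamma (\<alpha> * real (Suc n)) * (indicator {0<..<t} y *
            ((t - y) powr ((1 - \<alpha>) - 1) * (y - 0) powr (\<alpha> * real (Suc n) - 1))))
          (q / Gamma (\<alpha> * real (Suc n)) * ((t - 0) powr (\<alpha> * real (Suc n) + (1 - \<alpha>) - 1) * Beta (\<alpha> * real (Suc n)) (1 - \<alpha>)))"
        using \<alpha> \<open>\<alpha> < 1\<close> t
        by (intro has_bochner_integral_mult_right has_bochner_integral_Beta_kernel) auto
      moreover have e: "\<alpha> * real (Suc n) + (1 - \<alpha>) = \<alpha> * real n + 1" by (simp add: algebra_simps)
      have "q / Gamma (\<alpha> * real (Suc n)) * ((t - 0) powr (\<alpha> * real (Suc n) + (1 - \<alpha>) - 1) * Beta (\<alpha> * real (Suc n)) (1 - \<alpha>)) =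
          Gamma (1 - \<alpha>) * (q / Gamma (\<alpha> * real n + 1) * (t powr \<alpha>) ^ n)"
        using pos'[of n] t unfolding Beta_def e
        by (simp add: powr_powr[symmetric] powr_realpow del: of_nat_Suc)
      moreover have "q / Gamma (\<alpha> * real (Suc n)) * (indicator {0<..<t} y *
            ((t - y) powr ((1 - \<alpha>) - 1) * (y - 0) powr (\<alpha> * real (Suc n) - 1))) =
          indicator {0<..<t} y * ((t - y) powr (- \<alpha>) * (q / Gamma (\<alpha> * real (Suc n)) * y powr (\<alpha> * real (Suc n) - 1)))" for y
        by simp
      ultimately show ?thesis by (simp only:)
    qed
    have h: "has_bochner_integral lborel (h n) (Gamma (1 - \<alpha>) * (c (Suc n) / Gamma (\<alpha> * real n + 1) * (t powr \<alpha>) ^ n))" for n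
      unfolding h_def d_def by (rule hb)
    have h_abs: "norm (h n y) = indicator {0<..<t} y * ((t - y) powr (- \<alpha>) *
        (\<bar>c (Suc n)\<bar> / Gamma (\<alpha> * real (Suc n)) * y powr (\<alpha> * real (Suc n) - 1)))" for n y
      using pos'[of n] by (simp add: h_def d_def abs_mult del: of_nat_Suc)
    have int_abs: "(LINT y|lborel. norm (h n y)) =
        Gamma (1 - \<alpha>) * (\<bar>c (Suc n)\<bar> / Gamma (\<alpha> * real n + 1) * (t powr \<alpha>) ^ n)" for n
      unfolding h_abs using hb[of "\<bar>c (Suc n)\<bar>" n] by (simp only: has_bochner_integral_iff)
    have 1: "integrable lborel (h n)" for n using h[of n] by (simp add: has_bochner_integral_iff)
    have 2: "AE y in lborel. summable (\<lambda>n. norm (h n y))"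
    proof (rule AE_I2)
      fix y
      show "summable (\<lambda>n. norm (h n y))"
      proof (cases "y \<in> {0<..<t}")
        case True
        then have "norm (h n y) = (t - y) powr (- \<alpha>) * \<bar>d n y\<bar>" for n by (simp add: h_def abs_mult)
        then show ?thesis using d_summ[of y] True by (simp add: summable_mult)
      qed (simp add: h_def)
    qed
    have shift: "summable (\<lambda>n. \<bar>c (Suc n)\<bar> / Gamma (\<alpha> * real n + 1) * (t powr \<alpha>) ^ n)"
    proof -
      have "summable (\<lambda>n. \<bar>c (Suc n)\<bar> / Gamma (\<alpha> * real n + 1) * \<bar>t powr \<alpha>\<bar> ^ n)"
      proof (rule summable_comparison_test')
        have C: "0 \<le> C" using c[of 1] by simp
        then show "summable (\<lambda>n. C * (\<bar>C ^ n\<bar> / Gamma (\<alpha> * real n + 1) * \<bar>t powr \<alpha>\<bar> ^ n))"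
          by (intro summable_mult ml_summable[OF \<alpha>(1), where C = C]) auto
        show "norm (\<bar>c (Suc n)\<bar> / Gamma (\<alpha> * real n + 1) * \<bar>t powr \<alpha>\<bar> ^ n) \<le>
            C * (\<bar>C ^ n\<bar> / Gamma (\<alpha> * real n + 1) * \<bar>t powr \<alpha>\<bar> ^ n)" for n
          using mult_right_mono[OF divide_right_mono[OF c[of "Suc n"], of "Gamma (\<alpha> * real n + 1)"], of "\<bar>t powr \<alpha>\<bar> ^ n"]
            pos[of n] C by simp
      qed
      then show ?thesis by simp
    qed
    have 3: "summable (\<lambda>n. LINT y|lborel. norm (h n y))"
      unfolding int_abs by (intro summable_mult shift)
    have sum_h: "(\<Sum>n. h n y) = indicator {0<..<t} y *\<^sub>R ((t - y) powr (- \<alpha>) * deriv (ml_series \<alpha> c) y)" for y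
    proof (cases "y \<in> {0<..<t}")
      case True
      then have "summable (\<lambda>n. d n y)" using d_summ[of y] by (auto intro: summable_rabs_cancel)
      then show ?thesis using True by (simp add: h_def deriv suminf_mult)
    qed (simp add: h_def)
    have "summable (\<lambda>n. c (Suc n) / Gamma (\<alpha> * real n + 1) * (t powr \<alpha>) ^ n)"
    proof (rule summable_rabs_cancel)
      show "summable (\<lambda>n. \<bar>c (Suc n) / Gamma (\<alpha> * real n + 1) * (t powr \<alpha>) ^ n\<bar>)"
        using shift pos by (simp add: abs_mult less_imp_le)
    qed
    moreover have "integral\<^sup>L lborel (h n) =
        Gamma (1 - \<alpha>) * (c (Suc n) / Gamma (\<alpha> * real n + 1) * (t powr \<alpha>) ^ n)" for n
      using h[of n] by (simp only: has_bochner_integral_iff)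
    ultimately have "(\<Sum>n. integral\<^sup>L lborel (h n)) = Gamma (1 - \<alpha>) * ml_series \<alpha> (\<lambda>n. c (Suc n)) t"
      unfolding ml_series_def by (simp only: suminf_mult)
    then show ?thesis
      using integrable_suminf[OF 1 2 3] integral_suminf[OF 1 2 3]
      by (simp add: sum_h set_integrable_def set_lebesgue_integral_def)
  qed
  show "caputo_differentiable \<alpha> (ml_series \<alpha> c)"
    unfolding caputo_differentiable_def using cont der kernel
    by (auto simp: real_differentiable_def)
  assume t: "0 < t"
  show "caputo_deriv \<alpha> (ml_series \<alpha> c) t = ml_series \<alpha> (\<lambda>n. c (Suc n)) t"
  proof (cases "\<alpha> = 1")
    case True
    then show ?thesis using t unfolding caputo_deriv_def deriv[OF t] d_def ml_series_def
      by (simp add: powr_realpow add.commute)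
  next
    case False
    then have "\<alpha> < 1" using \<alpha> by simp
    moreover have "Gamma (1 - \<alpha>) \<noteq> 0"
      by (rule less_imp_neq[symmetric], rule Gamma_real_pos) (use \<open>\<alpha> < 1\<close> in simp)
    ultimately show ?thesis using kernel[OF t] False by (simp add: caputo_deriv_def)
  qed
qed

section \<open>The series solution of the queue equations\<close>

primrec MM1_coeff :: "real \<Rightarrow> real \<Rightarrow> nat \<Rightarrow> nat \<Rightarrow> nat \<Rightarrow> real" where
  "MM1_coeff lam \<mu> i 0 = (\<lambda>k. if k = i then 1 else 0)"
| "MM1_coeff lam \<mu> i (Suc n) = MM1_generator lam \<mu> (MM1_coeff lam \<mu> i n)"

lemma MM1_coeff_bound:
  assumes "0 < lam" "0 < \<mu>"
  shows "\<bar>MM1_coeff lam \<mu> i n k\<bar> \<le> (2 * (lam + \<mu>)) ^ n"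
proof (induction n arbitrary: k)
  case (Suc n)
  then show ?case using MM1_generator_bound[OF assms, of "MM1_coeff lam \<mu> i n"] by simp
qed simp

text \<open>The probabilities are constrained at times t \<ge> 0 only, whereas the series is a
  function on all reals. Agreement on the closed half-line suffices: a positive time has a
  neighbourhood inside it, and at 0 only one-sided continuity is asked.\<close>

lemma caputo_cong:
  assumes "\<And>t. 0 \<le> t \<Longrightarrow> f t = g t"
  shows "caputo_differentiable \<alpha> f \<longleftrightarrow> caputo_differentiable \<alpha> g"
    and "0 < t \<Longrightarrow> caputo_deriv \<alpha> f t = caputo_deriv \<alpha> g t"
proof -
  have ev: "\<forall>\<^sub>F x in nhds t. f x = g x" if "0 < t" for t
    using eventually_nhds_in_open[of "{0<..}" t] that assms by (auto elim!: eventually_mono)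
  have d: "deriv f t = deriv g t" if "0 < t" for t
    using ev[OF that] by (intro deriv_cong_ev) auto
  have "f differentiable at t \<longleftrightarrow> g differentiable at t" if "0 < t" for t
    using DERIV_cong_ev[OF refl ev[OF that] refl] by (simp add: real_differentiable_def)
  moreover have eq: "indicator {0<..<t} y *\<^sub>R ((t - y) powr - \<alpha> * deriv f y) =
      indicator {0<..<t} y *\<^sub>R ((t - y) powr - \<alpha> * deriv g y)" for t y
    by (auto simp: indicator_def d)
  moreover have "continuous_on {0..} f \<longleftrightarrow> continuous_on {0..} g"
    using assms by (intro continuous_on_cong) auto
  ultimately show "caputo_differentiable \<alpha> f \<longleftrightarrow> caputo_differentiable \<alpha> g"
    unfolding caputo_differentiable_def set_integrable_def eq by auto
  show "caputo_deriv \<alpha> f t = caputo_deriv \<alpha> g t" if "0 < t"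
    unfolding caputo_deriv_def set_lebesgue_integral_def eq d[OF that] ..
qed

text \<open>Each component of the generator is a finite linear combination and hence commutes with
  the summation over n; the recursion for \<open>MM1_coeff\<close> turns the shift produced by the
  Caputo derivative into one application of the generator.\<close>

lemma MM1_series_caputo:
  assumes \<alpha>: "0 < \<alpha>" "\<alpha> \<le> 1" and rates: "0 < lam" "0 < \<mu>"
  shows "caputo_differentiable \<alpha> (ml_series \<alpha> (\<lambda>n. MM1_coeff lam \<mu> i n k))"
    and "0 < t \<Longrightarrow> caputo_deriv \<alpha> (ml_series \<alpha> (\<lambda>n. MM1_coeff lam \<mu> i n k)) t =
      MM1_generator lam \<mu> (\<lambda>k. ml_series \<alpha> (\<lambda>n. MM1_coeff lam \<mu> i n k) t) k"
proof -
  note b = MM1_coeff_bound[OF rates]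
  show "caputo_differentiable \<alpha> (ml_series \<alpha> (\<lambda>n. MM1_coeff lam \<mu> i n k))"
    by (rule ml_series_caputo(1)[OF \<alpha> b])
  define x where "x = (\<lambda>k n. MM1_coeff lam \<mu> i n k / Gamma (\<alpha> * real n + 1) * (t powr \<alpha>) ^ n)"
  have x: "summable (x k)" for k
  proof (rule summable_rabs_cancel)
    have "0 < Gamma (\<alpha> * real n + 1)" for n using \<alpha> by (intro Gamma_real_pos add_nonneg_pos) auto
    then have "\<bar>x k n\<bar> = \<bar>MM1_coeff lam \<mu> i n k\<bar> / Gamma (\<alpha> * real n + 1) * \<bar>t powr \<alpha>\<bar> ^ n" for n
      by (simp add: x_def abs_mult abs_of_pos)
    then show "summable (\<lambda>n. \<bar>x k n\<bar>)" using ml_summable[OF \<alpha>(1) MM1_coeff_bound[OF rates, where i = i and k = k], of "t powr \<alpha>"] by simp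
  qed
  assume t: "0 < t"
  have "(\<lambda>n. MM1_coeff lam \<mu> i (Suc n) k / Gamma (\<alpha> * real n + 1) * (t powr \<alpha>) ^ n) =
      (\<lambda>n. MM1_generator lam \<mu> (\<lambda>k. x k n) k)"
    unfolding x_def times_divide_eq_left times_divide_eq_right [symmetric]
    by (rule ext) (simp only: MM1_coeff.simps MM1_generator_mult_right)
  moreover have "(\<lambda>n. MM1_generator lam \<mu> (\<lambda>k. x k n) k) sums MM1_generator lam \<mu> (\<lambda>k. suminf (x k)) k"
  proof (cases "k = 0")
    case True
    have "(\<lambda>n. - lam * x 0 n + \<mu> * x 1 n) sums (- lam * suminf (x 0) + \<mu> * suminf (x 1))"
      by (intro sums_add sums_mult summable_sums x)
    then show ?thesis using True by (simp add: MM1_generator_def)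
  next
    case False
    have "(\<lambda>n. - (lam + \<mu>) * x k n + lam * x (k - 1) n + \<mu> * x (k + 1) n) sums
        (- (lam + \<mu>) * suminf (x k) + lam * suminf (x (k - 1)) + \<mu> * suminf (x (k + 1)))"
      by (intro sums_add sums_mult summable_sums x)
    then show ?thesis using False by (simp add: MM1_generator_def)
  qed
  ultimately have "ml_series \<alpha> (\<lambda>n. MM1_coeff lam \<mu> i (Suc n) k) t = MM1_generator lam \<mu> (\<lambda>k. suminf (x k)) k"
    by (simp add: ml_series_def sums_iff)
  then show "caputo_deriv \<alpha> (ml_series \<alpha> (\<lambda>n. MM1_coeff lam \<mu> i n k)) t =
      MM1_generator lam \<mu> (\<lambda>k. ml_series \<alpha> (\<lambda>n. MM1_coeff lam \<mu> i n k) t) k"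
    by (simp only: ml_series_caputo(2)[OF \<alpha> b t] ml_series_def x_def)
qed

text \<open>Uniqueness is applied on [0, t], with the bound 1 for the probabilities, which are
  nonnegative and sum to 1, and a bound for the series that is the same for all states.\<close>

lemma fractional_MM1_probs_eq_series:
  assumes \<alpha>: "0 < \<alpha>" "\<alpha> \<le> 1" and rates: "0 < lam" "0 < \<mu>"
    and p: "fractional_MM1_probs \<alpha> lam \<mu> i p" and t: "0 \<le> t"
  shows "p k t = ml_series \<alpha> (\<lambda>n. MM1_coeff lam \<mu> i n k) t"
proof -
  note b = MM1_coeff_bound[OF rates]
  have C: "0 \<le> 2 * (lam + \<mu>)" using rates by simp
  obtain L where L: "\<And>c u. (\<And>n. \<bar>c n\<bar> \<le> (2 * (lam + \<mu>)) ^ n) \<Longrightarrow> 0 \<le> u \<Longrightarrow> u \<le> t \<Longrightarrow> \<bar>ml_series \<alpha> c u\<bar> \<le> L"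
    using ml_series_bounded[OF \<alpha>(1) C, where T = t] by blast
  note series = MM1_series_caputo[OF \<alpha> rates, where i = i]
  have p_diff: "caputo_differentiable \<alpha> (p k)" for k
    using p by (simp add: fractional_MM1_probs_def)
  have p_bound: "\<bar>p k u\<bar> \<le> 1" if "0 \<le> u" "u \<le> t" for k u
  proof -
    have "\<And>j. 0 \<le> p j u" "(\<lambda>k. p k u) sums 1" using p that by (auto simp: fractional_MM1_probs_def)
    then show ?thesis using sum_le_suminf[of "\<lambda>k. p k u" "{k}"] by (simp add: sums_iff)
  qed
  have p_eq: "caputo_deriv \<alpha> (p k) u = MM1_generator lam \<mu> (\<lambda>k. p k u) k" if "0 < u" for k u
    using p that by (simp add: fractional_MM1_probs_def MM1_generator_def)
  have p_init: "p k 0 = ml_series \<alpha> (\<lambda>n. MM1_coeff lam \<mu> i n k) 0" for k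
    using p by (simp add: fractional_MM1_probs_def)
  show ?thesis
    by (rule fractional_MM1_unique[OF \<alpha> rates p_diff p_eq series p_init p_bound L[OF b] t order_refl])
qed

text \<open>Nonnegativity and total mass 1 are not visible from the series, whose coefficients have
  mixed signs. They enter as hypotheses, to be supplied by the fact that q consists of probabilities
  of events.\<close>

lemma fractional_MM1_probs_of_series:
  assumes \<alpha>: "0 < \<alpha>" "\<alpha> \<le> 1" and rates: "0 < lam" "0 < \<mu>"
    and prob: "\<And>k t. 0 \<le> t \<Longrightarrow> 0 \<le> q k t" "\<And>t. 0 \<le> t \<Longrightarrow> (\<lambda>k. q k t) sums 1"
    and q: "\<And>k t. 0 \<le> t \<Longrightarrow> q k t = ml_series \<alpha> (\<lambda>n. MM1_coeff lam \<mu> i n k) t"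
  shows "fractional_MM1_probs \<alpha> lam \<mu> i q"
proof -
  note series = MM1_series_caputo[OF \<alpha> rates]
  have d: "caputo_differentiable \<alpha> (q k)" for k
    by (rule iffD2[OF caputo_cong(1) series(1)]) (rule q)
  have "caputo_deriv \<alpha> (q k) t = MM1_generator lam \<mu> (\<lambda>k. q k t) k" if "0 < t" for k t
  proof -
    have "caputo_deriv \<alpha> (q k) t = caputo_deriv \<alpha> (ml_series \<alpha> (\<lambda>n. MM1_coeff lam \<mu> i n k)) t"
      by (rule caputo_cong(2)[OF q that])
    then show ?thesis using series(2)[OF that] q that by simp
  qed
  moreover have "q k 0 = (if k = i then 1 else 0)" for k using q[of 0 k] by simp
  ultimately show ?thesis using prob d
    by (auto simp: fractional_MM1_probs_def MM1_generator_def)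
qed

section \<open>Uniqueness of Laplace transforms\<close>

lemma set_integrable_exp_bound:
  fixes f :: "real \<Rightarrow> real"
  assumes "continuous_on {0..} f" "\<And>t. 0 \<le> t \<Longrightarrow> \<bar>f t\<bar> \<le> C * exp (- t)"
  shows "set_integrable lborel {0..} f"
proof -
  have "integrable lborel (\<lambda>t::real. exp (- t) * indicator {0..} t)"
    using nn_intergal_power_times_exp_Ici[of 0]
    by (intro integrableI_nn_integral_finite[where x = 1]) (auto simp: ennreal_mult'' ennreal_indicator)
  then have "integrable lborel (\<lambda>t. C * (exp (- t) * indicator {0..} t))" by simp
  then show ?thesis unfolding set_integrable_def
  proof (rule Bochner_Integration.integrable_bound)
    show "(\<lambda>t. indicator {0..} t *\<^sub>R f t) \<in> borel_measurable lborel"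
      using borel_measurable_continuous_on_indicator[OF _ assms(1)] by simp
    show "AE t in lborel. norm (indicator {0..} t *\<^sub>R f t) \<le> norm (C * (exp (- t) * indicator {0..} t))"
      using assms(2) by (intro AE_I2) (auto simp: indicator_def intro: order_trans[OF _ abs_ge_self])
  qed
qed

text \<open>A form of Lerch's theorem. Under x = exp (- t) the function g becomes a continuous
  function h on [0, 1], and g is orthogonal to all polynomials in exp (- t); uniform approximation
  of h by a polynomial makes the integral of the square of g arbitrarily small.\<close>

lemma weighted_Weierstrass_zero:
  fixes g :: "real \<Rightarrow> real"
  assumes cont: "continuous_on {0..} g"
    and bound: "\<And>t. 0 \<le> t \<Longrightarrow> \<bar>g t\<bar> \<le> C * exp (- t)"
    and zero: "\<And>n :: nat. (LBINT t:{0..}. exp (- real n * t) * g t) = 0"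
    and "0 \<le> t"
  shows "g t = 0"
proof -
  have C: "0 \<le> C" using bound[of 0] by simp
  \<comment> \<open>The decay of g forces g (- ln x) to tend to 0 at x = 0, so this value makes h
    continuous on the compact interval.\<close>
  define h where "h = (\<lambda>x. if x = 0 then 0 else g (- ln x))"
  have h_cont: "continuous_on {0..1} h"
    unfolding continuous_on_eq_continuous_within
  proof
    fix x :: real assume x: "x \<in> {0..1}"
    show "continuous (at x within {0..1}) h"
    proof (cases "x = 0")
      case True
      have "(h \<longlongrightarrow> 0) (at 0 within {0..1})"
      proof (rule Lim_null_comparison)
        have "norm (h y) \<le> C * y" if "y \<in> {0..1}" for y
          using that bound[of "- ln y"] C by (auto simp: h_def ln_le_zero_iff)
        then show "\<forall>\<^sub>F y in at 0 within {0..1}. norm (h y) \<le> C * y"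
          by (auto simp: eventually_at_filter)
        show "((\<lambda>y. C * y) \<longlongrightarrow> 0) (at 0 within {0..1})"
          by (auto intro!: tendsto_eq_intros)
      qed
      then show ?thesis using True by (simp add: continuous_within h_def)
    next
      case False
      with x have x: "0 < x" "x \<le> 1" by auto
      have "continuous_on {0<..1} (\<lambda>x. g (- ln x))"
        by (rule continuous_on_compose2[OF cont]) (auto intro!: continuous_intros simp: ln_le_zero_iff)
      then have "continuous_on {0<..1} h"
        by (rule continuous_on_eq) (auto simp: h_def)
      then have "continuous (at x within {0<..1}) h"
        using x by (auto simp: continuous_on_eq_continuous_within)
      moreover have "at x within {0..1} = at x within {0<..1}"
        using x by (intro at_within_nhd[of _ "{0<..}"]) auto
      ultimately show ?thesis by simp
    qed
  qed
  have hg: "h (exp (- t)) = g t" for t by (simp add: h_def)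
  have int: "set_integrable lborel {0..} (\<lambda>t. k t * g t)"
    if k: "continuous_on {0..} k" and kb: "\<And>t. 0 \<le> t \<Longrightarrow> \<bar>k t\<bar> \<le> D" for k D
  proof (rule set_integrable_exp_bound)
    show "continuous_on {0..} (\<lambda>t. k t * g t)" by (intro continuous_intros k cont)
    show "\<bar>k t * g t\<bar> \<le> (D * C) * exp (- t)" if "0 \<le> t" for t
      using mult_mono[OF kb[OF that] bound[OF that]] kb[OF that] by (simp add: abs_mult mult.assoc)
  qed
  have poly0: "set_integrable lborel {0..} (\<lambda>t. p (exp (- t)) * g t) \<and>
      (LBINT t:{0..}. p (exp (- t)) * g t) = 0" if pp: "real_polynomial_function p" for p
  proof -
    obtain a n where p: "p = (\<lambda>x. \<Sum>i\<le>n. a i * x ^ i)"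
      using pp unfolding real_polynomial_function_iff_sum by (elim exE)
    have i: "set_integrable lborel {0..} (\<lambda>t. a i * (exp (- real i * t) * g t))" for i
      by (intro set_integrable_mult_right int[where D = 1]) (auto intro!: continuous_intros)
    have eq: "p (exp (- t)) * g t = (\<Sum>i\<le>n. a i * (exp (- real i * t) * g t))" for t
      unfolding p sum_distrib_right by (rule sum.cong) (simp_all add: exp_of_nat_mult [symmetric] mult.assoc)
    have "(LBINT t:{0..}. p (exp (- t)) * g t) =
        (\<Sum>i\<le>n. (LBINT t:{0..}. a i * (exp (- real i * t) * g t)))"
      using i unfolding eq set_lebesgue_integral_def set_integrable_def scaleR_sum_right
      by (intro Bochner_Integration.integral_sum)
    also have "\<dots> = 0" using zero by simp
    moreover have "set_integrable lborel {0..} (\<lambda>t. p (exp (- t)) * g t)"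
      using i unfolding eq set_integrable_def scaleR_sum_right
      by (intro Bochner_Integration.integrable_sum)
    ultimately show ?thesis by simp
  qed
  have intg: "set_integrable lborel {0..} (\<lambda>t. g t * g t)"
  proof (rule int[OF cont])
    show "\<bar>g t\<bar> \<le> C" if "0 \<le> t" for t
      using bound[OF that] mult_left_mono[OF _ C, of "exp (- t)" 1] that by simp
  qed
  have intC: "set_integrable lborel {0..} (\<lambda>t. C * exp (- t))"
    by (rule set_integrable_exp_bound[where C = C]) (use C in \<open>auto intro!: continuous_intros\<close>)
  define J where "J = (LBINT t:{0..}. C * exp (- t))"
  have J: "0 \<le> J" unfolding J_def set_lebesgue_integral_def
    using C by (intro integral_nonneg_AE) auto
  \<comment> \<open>Subtracting the vanishing integral of p (exp (- t)) * g t leaves a factor h - p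
    of size at most e, while \<open>J\<close> bounds the integral of |g|.\<close>
  have small: "(LBINT t:{0..}. g t * g t) \<le> e * J" if e: "0 < e" for e
  proof -
    obtain p where p: "real_polynomial_function p" "\<And>x. x \<in> {0..1} \<Longrightarrow> \<bar>h x - p x\<bar> < e"
      using Stone_Weierstrass_real_polynomial_function[OF compact_Icc h_cont e] by blast
    have "(LBINT t:{0..}. g t * g t) = (LBINT t:{0..}. g t * g t) - (LBINT t:{0..}. p (exp (- t)) * g t)"
      using poly0[OF p(1)] by simp
    also have "\<dots> = (LBINT t:{0..}. g t * g t - p (exp (- t)) * g t)"
      using poly0[OF p(1)] intg by (intro set_integral_diff(2)[symmetric]) auto
    also have "\<dots> \<le> (LBINT t:{0..}. e * (C * exp (- t)))"
    proof (rule set_integral_mono)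
      show "set_integrable lborel {0..} (\<lambda>t. g t * g t - p (exp (- t)) * g t)"
        using poly0[OF p(1)] intg by (intro set_integral_diff(1)) auto
      show "set_integrable lborel {0..} (\<lambda>t. e * (C * exp (- t)))"
        using intC by (rule set_integrable_mult_right)
      fix t :: real assume t: "t \<in> {0..}"
      have "g t * g t - p (exp (- t)) * g t = (h (exp (- t)) - p (exp (- t))) * g t"
        by (simp add: hg algebra_simps)
      also have "\<dots> \<le> \<bar>h (exp (- t)) - p (exp (- t))\<bar> * \<bar>g t\<bar>"
        by (metis abs_ge_self abs_mult)
      also have "\<dots> \<le> e * (C * exp (- t))"
        using p(2)[of "exp (- t)"] bound[of t] t e by (intro mult_mono) (auto simp: less_imp_le)
      finally show "g t * g t - p (exp (- t)) * g t \<le> e * (C * exp (- t))" .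
    qed
    finally show ?thesis by (simp add: J_def)
  qed
  have "(LBINT t:{0..}. g t * g t) \<le> 0"
  proof (rule field_le_epsilon)
    fix e :: real assume "0 < e"
    then have "e / (J + 1) * J \<le> e" "0 < e / (J + 1)" using J by (auto simp: field_simps)
    then show "(LBINT t:{0..}. g t * g t) \<le> 0 + e" using small[of "e / (J + 1)"] by simp
  qed
  then have le: "integral {0..} (\<lambda>t. g t * g t) \<le> 0"
    using set_borel_integral_eq_integral(2)[OF intg] by simp
  have i1: "(\<lambda>t. g t * g t) integrable_on {0..}"
    using set_borel_integral_eq_integral(1)[OF intg] .
  \<comment> \<open>The endpoint t + 1 keeps the interval nondegenerate when t = 0, so that a
    vanishing integral of the continuous nonnegative square forces it to vanish at t.\<close>
  have i2: "(\<lambda>t. g t * g t) integrable_on {0..t + 1}"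
    by (intro integrable_continuous_real continuous_intros continuous_on_subset[OF cont]) auto
  have "integral {0..t + 1} (\<lambda>t. g t * g t) \<le> integral {0..} (\<lambda>t. g t * g t)"
    by (intro integral_subset_le i1 i2) auto
  moreover have "0 \<le> integral {0..t + 1} (\<lambda>t. g t * g t)"
    by (intro integral_nonneg i2) auto
  ultimately have "((\<lambda>t. g t * g t) has_integral 0) (cbox 0 (t + 1))"
    using i2 le by (simp add: has_integral_integrable_integral)
  moreover have "continuous_on (cbox 0 (t + 1)) (\<lambda>t. g t * g t)"
    by (intro continuous_intros continuous_on_subset[OF cont]) auto
  ultimately have "g t * g t = 0"
    using \<open>0 \<le> t\<close> by (intro has_integral_0_cbox_imp_0[of 0 "t + 1"]) auto
  then show ?thesis by simp
qed

text \<open>Multiplication by exp (- 2 t) turns growth like exp t into decay like exp (- t), as the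
  orthogonality argument requires. The transform of the damped difference at n is that of the
  original one at n + 2, whence the integers from 2 on.\<close>

lemma Laplace_unique:
  fixes f g :: "real \<Rightarrow> real"
  assumes "continuous_on {0..} f" "continuous_on {0..} g"
    and "\<And>t. 0 \<le> t \<Longrightarrow> \<bar>f t\<bar> \<le> C * exp t" "\<And>t. 0 \<le> t \<Longrightarrow> \<bar>g t\<bar> \<le> D * exp t"
    and eq: "\<And>n :: nat. 2 \<le> n \<Longrightarrow> (LBINT t:{0..}. exp (- real n * t) * f t) = (LBINT t:{0..}. exp (- real n * t) * g t)"
    and t: "0 \<le> t"
  shows "f t = g t"
proof -
  have int: "set_integrable lborel {0..} (\<lambda>t. exp (- real n * t) * k t)"
    if "continuous_on {0..} k" "\<And>t. 0 \<le> t \<Longrightarrow> \<bar>k t\<bar> \<le> B * exp t" "2 \<le> n" for k :: "real \<Rightarrow> real" and B n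
  proof (rule set_integrable_exp_bound)
    show "continuous_on {0..} (\<lambda>t. exp (- real n * t) * k t)"
      by (intro continuous_intros that)
    show "\<bar>exp (- real n * t) * k t\<bar> \<le> B * exp (- t)" if t: "0 \<le> t" for t
    proof -
      have B: "0 \<le> B" using \<open>\<And>t. 0 \<le> t \<Longrightarrow> \<bar>k t\<bar> \<le> B * exp t\<close>[of 0] by simp
      have "exp (- real n * t) * \<bar>k t\<bar> \<le> exp (- 2 * t) * (B * exp t)"
        using \<open>\<And>t. 0 \<le> t \<Longrightarrow> \<bar>k t\<bar> \<le> B * exp t\<close>[OF t] \<open>2 \<le> n\<close> t
        by (intro mult_mono) (auto intro: mult_right_mono)
      also have "\<dots> = B * (exp (- 2 * t) * exp t)" by simp
      also have "exp (- 2 * t) * exp t = exp (- t)" by (simp add: exp_add [symmetric])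
      finally show ?thesis by (simp add: abs_mult)
    qed
  qed
  have "exp (- 2 * t) * (f t - g t) = 0"
  proof (rule weighted_Weierstrass_zero[where g = "\<lambda>t. exp (- 2 * t) * (f t - g t)"])
    show "continuous_on {0..} (\<lambda>t. exp (- 2 * t) * (f t - g t))"
      by (intro continuous_intros assms)
    show "\<bar>exp (- 2 * t) * (f t - g t)\<bar> \<le> (C + D) * exp (- t)" if "0 \<le> t" for t
    proof -
      have "\<bar>f t - g t\<bar> \<le> (C + D) * exp t"
        using assms(3,4)[OF that] by (simp add: algebra_simps)
      then have "exp (- 2 * t) * \<bar>f t - g t\<bar> \<le> exp (- 2 * t) * ((C + D) * exp t)"
        by (intro mult_left_mono) auto
      also have "\<dots> = (C + D) * (exp (- 2 * t) * exp t)" by simp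
      also have "exp (- 2 * t) * exp t = exp (- t)" by (simp add: exp_add [symmetric])
      finally show ?thesis by (simp add: abs_mult)
    qed
    show "(LBINT t:{0..}. exp (- real n * t) * (exp (- 2 * t) * (f t - g t))) = 0" for n :: nat
    proof -
      have "exp (- real n * t) * (exp (- 2 * t) * (f t - g t)) =
          exp (- real (n + 2) * t) * f t - exp (- real (n + 2) * t) * g t" for t
      proof -
        have "exp (- real (n + 2) * t) = exp (- real n * t) * exp (- 2 * t)"
          by (simp add: exp_add [symmetric] algebra_simps)
        then show ?thesis by (simp add: algebra_simps)
      qed
      then show ?thesis
        using eq[of "n + 2"] int[OF assms(1,3), of "n + 2"] int[OF assms(2,4), of "n + 2"]
        by (simp add: set_integral_diff)
    qed
  qed (rule t)
  then show ?thesis by simp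
qed

section \<open>Moments of the inverse stable subordinator\<close>

lemma inverse_subordinator_nonneg: "0 \<le> inverse_subordinator V t \<omega>"
  by (auto simp: inverse_subordinator_def intro!: cInf_greatest)

lemma inverse_subordinator_le:
  assumes "0 < s" "t < V s \<omega>"
  shows "inverse_subordinator V t \<omega> \<le> s"
proof -
  have "Inf {s. 0 < s \<and> t < V s \<omega>} \<le> s"
    using assms by (intro cInf_lower) (auto intro!: bdd_belowI[of _ 0])
  then show ?thesis using assms by (auto simp: inverse_subordinator_def)
qed

text \<open>Monotonicity forces every r with t < V r to be at least s. The second hypothesis keeps
  the set nonempty, so that the default value 0 does not intervene.\<close>

lemma inverse_subordinator_ge:
  assumes "mono_on {0..} (\<lambda>s. V s \<omega>)" "\<exists>r>0. t < V r \<omega>" "0 \<le> s" "V s \<omega> \<le> t"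
  shows "s \<le> inverse_subordinator V t \<omega>"
proof -
  have "s \<le> Inf {s. 0 < s \<and> t < V s \<omega>}"
  proof (rule cInf_greatest)
    fix r assume r: "r \<in> {s. 0 < s \<and> t < V s \<omega>}"
    show "s \<le> r"
    proof (rule ccontr)
      assume "\<not> s \<le> r"
      then have "V r \<omega> \<le> V s \<omega>" using assms(1,3) r by (auto simp: mono_on_def)
      then show False using r assms(4) by simp
    qed
  qed (use assms in auto)
  then show ?thesis using assms(2) by (auto simp: inverse_subordinator_def)
qed

lemma inverse_subordinator_less_iff:
  assumes "\<exists>r>0. t < V r \<omega>"
  shows "inverse_subordinator V t \<omega> < a \<longleftrightarrow> (\<exists>r>0. r < a \<and> t < V r \<omega>)"
proof -
  have "Inf {s. 0 < s \<and> t < V s \<omega>} < a \<longleftrightarrow> (\<exists>r\<in>{s. 0 < s \<and> t < V s \<omega>}. r < a)"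
    using assms by (intro cInf_less_iff) (auto intro!: bdd_belowI[of _ 0])
  then show ?thesis using assms by (auto simp: inverse_subordinator_def)
qed

lemma inverse_subordinator_mono:
  assumes "\<exists>r>0. u < V r \<omega>" "t \<le> u"
  shows "inverse_subordinator V t \<omega> \<le> inverse_subordinator V u \<omega>"
proof (rule field_le_epsilon)
  fix e :: real assume "0 < e"
  then obtain r where "0 < r" "r < inverse_subordinator V u \<omega> + e" "u < V r \<omega>"
    using inverse_subordinator_less_iff[of u V \<omega>, OF assms(1), of "inverse_subordinator V u \<omega> + e"] by auto
  then show "inverse_subordinator V t \<omega> \<le> inverse_subordinator V u \<omega> + e"
    using inverse_subordinator_le[of r t V \<omega>] assms(2) by simp
qed

text \<open>The upper half comes from the strict inequality t < V r, which persists for nearby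
  times. The lower half needs V strictly increasing, since E jumps where V is constant.\<close>

lemma inverse_subordinator_continuous:
  assumes mono: "mono_on {0..} (\<lambda>s. V s \<omega>)" and unbounded: "\<And>t. \<exists>r>0. t < V r \<omega>"
    and strict: "\<And>r s. 0 \<le> r \<Longrightarrow> r < s \<Longrightarrow> V r \<omega> < V s \<omega>"
  shows "isCont (\<lambda>t. inverse_subordinator V t \<omega>) t"
  unfolding isCont_def
proof (rule order_tendstoI)
  let ?E = "\<lambda>t. inverse_subordinator V t \<omega>"
  fix a assume a: "?E t < a"
  then obtain r where r: "0 < r" "r < a" "t < V r \<omega>"
    using inverse_subordinator_less_iff[of t V \<omega>, OF unbounded] by blast
  have "\<forall>\<^sub>F u in at t. u < V r \<omega>" using r(3) by (rule order_tendstoD[OF tendsto_ident_at])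
  then show "\<forall>\<^sub>F u in at t. ?E u < a"
    by eventually_elim (rule le_less_trans[OF inverse_subordinator_le[where s = r] r(2)], rule r(1))
next
  let ?E = "\<lambda>t. inverse_subordinator V t \<omega>"
  fix a assume a: "a < ?E t"
  show "\<forall>\<^sub>F u in at t. a < ?E u"
  proof (cases "a < 0")
    case True
    then show ?thesis by (intro always_eventually allI less_le_trans[OF _ inverse_subordinator_nonneg])
  next
    case False
    \<comment> \<open>Two points below \<open>?E t\<close>: c gives only the weak inequality V c
      \<le> t, and strict increase from b to c makes V b < t, which is stable under small changes of
      t.\<close>
    define b where "b = (a + ?E t) / 2"
    define c where "c = (b + ?E t) / 2"
    have bc: "a < b" "b < c" "c < ?E t" "0 \<le> b" using a False by (auto simp: b_def c_def)
    have "V b \<omega> < V c \<omega>" using strict bc by auto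
    also have "V c \<omega> \<le> t" using inverse_subordinator_le[of c t V \<omega>] bc by force
    finally have "\<forall>\<^sub>F u in at t. V b \<omega> < u" by (rule order_tendstoD[OF tendsto_ident_at])
    then show ?thesis
    proof eventually_elim
      case (elim u)
      then have "b \<le> ?E u" using bc by (intro inverse_subordinator_ge mono unbounded) auto
      then show ?case using bc by simp
    qed
  qed
qed

section \<open>Elementary integrals for the moment computation\<close>

lemma nn_integral_exp_tail:
  fixes \<xi> w :: real
  assumes "0 < \<xi>" "0 \<le> w"
  shows "(\<integral>\<^sup>+t. ennreal (indicator {0..} t * exp (- \<xi> * t)) * indicator {w..} t \<partial>lborel) = ennreal (exp (- \<xi> * w) / \<xi>)"
proof -
  have "(\<integral>\<^sup>+t. ennreal (exp (- \<xi> * t)) * indicator {w..} t \<partial>lborel) = ennreal (0 - (- exp (- \<xi> * w) / \<xi>))"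
  proof (rule nn_integral_FTC_atLeast[where F = "\<lambda>t. - exp (- \<xi> * t) / \<xi>"])
    show "((\<lambda>t. - exp (- \<xi> * t) / \<xi>) has_real_derivative exp (- \<xi> * t)) (at t)" for t
      using assms by (auto intro!: derivative_eq_intros)
    have "((\<lambda>t. - exp (- \<xi> * t) / \<xi>) \<longlongrightarrow> - 0 / \<xi>) at_top"
      using assms by (intro tendsto_intros filterlim_compose[OF exp_at_bot])
        (auto simp: filterlim_uminus_at_bot filterlim_ident intro!: filterlim_tendsto_pos_mult_at_top[OF tendsto_const])
    then show "((\<lambda>t. - exp (- \<xi> * t) / \<xi>) \<longlongrightarrow> 0) at_top" by simp
  qed auto
  moreover have "ennreal (indicator {0..} t * exp (- \<xi> * t)) * indicator {w..} t =
      ennreal (exp (- \<xi> * t)) * indicator {w..} t" for t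
    using assms by (auto simp: indicator_def)
  ultimately show ?thesis by simp
qed

text \<open>Up to the factor on the right the integrand is the Erlang density, whose moment of order
  0 is its total mass 1.\<close>

lemma nn_integral_power_exp:
  fixes l :: real
  assumes "0 < l"
  shows "(\<integral>\<^sup>+s. ennreal (indicator {0..} s * s ^ m * exp (- s * l)) \<partial>lborel) = ennreal (fact m / l ^ Suc m)"
proof -
  have "ennreal (indicator {0..} s * s ^ m * exp (- s * l)) =
      ennreal (fact m / l ^ Suc m) * ennreal (erlang_density m l s * s ^ 0)" for s
    using assms by (auto simp: erlang_density_def ennreal_mult'[symmetric] indicator_def mult.commute)
  then show ?thesis
    using nn_integral_erlang_ith_moment[OF assms, of m 0] assms by (simp add: nn_integral_cmult)
qed

text \<open>The layer-cake formula for a power; with e = E t it expresses moments through the events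
  s \<le> E t.\<close>

lemma nn_integral_power_Icc:
  fixes e :: real
  assumes "0 \<le> e"
  shows "(\<integral>\<^sup>+s. ennreal (real (Suc m) * s ^ m) * indicator {0..e} s \<partial>lborel) = ennreal (e ^ Suc m)"
proof -
  have "(\<integral>\<^sup>+s. ennreal (real (Suc m) * s ^ m) * indicator {0..e} s \<partial>lborel) = ennreal (e ^ Suc m - 0 ^ Suc m)"
  proof (rule nn_integral_FTC_Icc)
    show "((\<lambda>s. s ^ Suc m) has_real_derivative real (Suc m) * s ^ m) (at s)" for s :: real
      using DERIV_pow[of "Suc m" s] by simp
  qed (use assms in auto)
  then show ?thesis by simp
qed

lemma Laplace_powr:
  fixes a \<xi> :: real
  assumes "0 < \<alpha>" "0 < \<xi>"
  shows "(LBINT t:{0..}. exp (- \<xi> * t) * (t powr \<alpha>) ^ n) = Gamma (\<alpha> * real n + 1) / (\<xi> * (\<xi> powr \<alpha>) ^ n)"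
proof -
  let ?a = "\<alpha> * real n + 1"
  let ?f = "\<lambda>u::real. indicator {..0} u * ((0 - u) powr (?a - 1) * exp (\<xi> * u))"
  have "has_bochner_integral lborel ?f (exp (\<xi> * 0) * Gamma ?a / \<xi> powr ?a)"
    using assms by (intro has_bochner_integral_Gamma_kernel) (auto intro: add_nonneg_pos)
  then have "has_bochner_integral lborel (\<lambda>t. ?f (0 + (- 1) * t)) ((exp (\<xi> * 0) * Gamma ?a / \<xi> powr ?a) /\<^sub>R \<bar>- 1\<bar>)"
    by (subst lborel_has_bochner_integral_real_affine_iff[symmetric]) auto
  then have "integral\<^sup>L lborel (\<lambda>t. ?f (0 + (- 1) * t)) = Gamma ?a / \<xi> powr ?a"
    by (simp add: has_bochner_integral_iff)
  moreover have "(LBINT t:{0..}. exp (- \<xi> * t) * (t powr \<alpha>) ^ n) = integral\<^sup>L lborel (\<lambda>t. ?f (0 + (- 1) * t))"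
    unfolding set_lebesgue_integral_def
  proof (rule integral_cong_AE)
    \<comment> \<open>At t = 0 and n = 0 the two integrands differ, since 0 ^ 0 = 1 but 0 powr 0 =
      0; a single point is negligible.\<close>
    have "AE t in lborel. t \<noteq> (0::real)" by (rule AE_lborel_singleton)
    then show "AE t in lborel. indicator {0..} t *\<^sub>R (exp (- \<xi> * t) * (t powr \<alpha>) ^ n) = ?f (0 + (- 1) * t)"
      by eventually_elim (auto simp: indicator_def powr_powr[symmetric] powr_realpow)
  qed auto
  moreover have "\<xi> powr ?a = \<xi> * (\<xi> powr \<alpha>) ^ n"
    using assms by (simp add: powr_add powr_powr[symmetric] powr_realpow)
  ultimately show ?thesis by simp
qed

section \<open>Almost sure path properties of the stable subordinator\<close>

locale stable_subordinator_space = prob_space M for M :: "'a measure" +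
  fixes \<alpha> :: real and V :: "real \<Rightarrow> 'a \<Rightarrow> real"
  assumes \<alpha>: "0 < \<alpha>" "\<alpha> \<le> 1" and subordinator: "stable_subordinator M \<alpha> V"
begin

lemma V_measurable: "0 \<le> t \<Longrightarrow> V t \<in> borel_measurable M"
  using subordinator by (simp add: stable_subordinator_def)

lemma V_mono: "\<omega> \<in> space M \<Longrightarrow> mono_on {0..} (\<lambda>t. V t \<omega>)"
  using subordinator by (simp add: stable_subordinator_def)

lemma V_mono': "\<omega> \<in> space M \<Longrightarrow> 0 \<le> s \<Longrightarrow> s \<le> t \<Longrightarrow> V s \<omega> \<le> V t \<omega>"
  using V_mono[of \<omega>] by (auto simp: mono_on_def)

lemma V_right_continuous: "\<omega> \<in> space M \<Longrightarrow> 0 \<le> t \<Longrightarrow> continuous (at_right t) (\<lambda>s. V s \<omega>)"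
  using subordinator by (simp add: stable_subordinator_def)

lemma AE_V_nonneg: "AE \<omega> in M. \<forall>t\<ge>0. 0 \<le> V t \<omega>"
proof -
  have "AE \<omega> in M. V 0 \<omega> = 0" using subordinator by (simp add: stable_subordinator_def)
  then show ?thesis
    using AE_space by eventually_elim (use V_mono' in fastforce)
qed

lemma V_Laplace:
  assumes "0 \<le> t" "0 < \<xi>"
  shows "(\<integral>\<^sup>+\<omega>. ennreal (exp (- \<xi> * V t \<omega>)) \<partial>M) = ennreal (exp (- t * \<xi> powr \<alpha>))"
proof -
  have "AE \<omega> in M. norm (exp (- \<xi> * V t \<omega>)) \<le> 1"
    using AE_V_nonneg by eventually_elim (use assms in auto)
  then have "integrable M (\<lambda>\<omega>. exp (- \<xi> * V t \<omega>))"
    using V_measurable[OF assms(1)] by (intro integrable_const_bound[where B = 1]) auto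
  then have "(\<integral>\<^sup>+\<omega>. ennreal (exp (- \<xi> * V t \<omega>)) \<partial>M) = ennreal (LINT \<omega>|M. exp (- \<xi> * V t \<omega>))"
    by (rule nn_integral_eq_integral) auto
  then show ?thesis using subordinator assms by (simp add: stable_subordinator_def)
qed

text \<open>Chernoff's bound: on V s \<le> t one has 1 \<le> exp (\<xi> (t - V s)), whose
  expectation is known from the Laplace transform. The freedom in \<xi> is used both at \<xi> = 1
  and in the limit of large \<xi>.\<close>

lemma V_tail:
  assumes "0 \<le> s" "0 < \<xi>"
  shows "(\<integral>\<^sup>+\<omega>. indicator {..t} (V s \<omega>) \<partial>M) \<le> ennreal (exp (\<xi> * t - s * \<xi> powr \<alpha>))"
proof -
  have [measurable]: "V s \<in> borel_measurable M" using assms by (intro V_measurable)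
  have "(\<integral>\<^sup>+\<omega>. indicator {..t} (V s \<omega>) \<partial>M) \<le> (\<integral>\<^sup>+\<omega>. ennreal (exp (\<xi> * t)) * ennreal (exp (- \<xi> * V s \<omega>)) \<partial>M)"
    using assms by (intro nn_integral_mono)
      (auto simp: indicator_def ennreal_mult'[symmetric] exp_add[symmetric] simp flip: ennreal_1 intro!: ennreal_leI)
  also have "\<dots> = ennreal (exp (\<xi> * t)) * ennreal (exp (- s * \<xi> powr \<alpha>))"
    by (subst nn_integral_cmult) (simp_all only: V_Laplace[OF assms], measurable)
  also have "\<dots> = ennreal (exp (\<xi> * t - s * \<xi> powr \<alpha>))"
    by (simp add: ennreal_mult'[symmetric] exp_add[symmetric])
  finally show ?thesis .
qed

lemma prob_V_le:
  assumes "0 \<le> s" "0 < \<xi>"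
  shows "prob {\<omega> \<in> space M. V s \<omega> \<le> t} \<le> exp (\<xi> * t - s * \<xi> powr \<alpha>)"
proof -
  have [measurable]: "V s \<in> borel_measurable M" using assms by (intro V_measurable)
  have "emeasure M {\<omega> \<in> space M. V s \<omega> \<le> t} = (\<integral>\<^sup>+\<omega>. indicator {\<omega> \<in> space M. V s \<omega> \<le> t} \<omega> \<partial>M)"
    by simp
  also have "\<dots> = (\<integral>\<^sup>+\<omega>. indicator {..t} (V s \<omega>) \<partial>M)"
    by (intro nn_integral_cong) (auto simp: indicator_def)
  finally have "ennreal (prob {\<omega> \<in> space M. V s \<omega> \<le> t}) \<le> ennreal (exp (\<xi> * t - s * \<xi> powr \<alpha>))"
    using V_tail[OF assms] by (simp add: emeasure_eq_measure)
  then show ?thesis by (subst (asm) ennreal_le_iff) auto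
qed

text \<open>At \<xi> = 1 the Chernoff bound for V (n + 1) \<le> m decays like exp (- n), so for
  fixed m these events almost surely do not all occur. On unbounded paths the default value in the
  definition of E never arises, for all t at once.\<close>

lemma AE_V_unbounded: "AE \<omega> in M. \<forall>t. \<exists>s>0. t < V s \<omega>"
proof -
  have "AE \<omega> in M. \<exists>s>0. real m < V s \<omega>" for m :: nat
  proof -
    have "AE \<omega> in M. \<exists>n. real m < V (real (Suc n)) \<omega>"
    proof -
      let ?A = "\<lambda>n. {\<omega> \<in> space M. V (real (Suc n)) \<omega> \<le> real m}"
      have [measurable]: "V (real (Suc n)) \<in> borel_measurable M" for n by (intro V_measurable) auto
      have A: "?A n \<in> events" for n by measurable
      have I: "(\<Inter>n. ?A n) \<in> events" by measurable
      have "prob (\<Inter>n. ?A n) \<le> exp (real m - real (Suc n))" for n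
      proof -
        have "prob (\<Inter>n. ?A n) \<le> prob (?A n)" by (intro finite_measure_mono A) blast
        also have "\<dots> \<le> exp (real m - real (Suc n))"
          using prob_V_le[of "real (Suc n)" 1 "real m"] by simp
        finally show ?thesis .
      qed
      moreover have "(\<lambda>n. exp (real m - real (Suc n))) \<longlonglongrightarrow> 0"
        by real_asymp
      ultimately have "prob (\<Inter>n. ?A n) \<le> 0"
        by (intro LIMSEQ_le_const[of _ 0]) auto
      then have "(\<Inter>n. ?A n) \<in> null_sets M"
        using I by (simp add: null_sets_def emeasure_eq_measure measure_le_0_iff)
      then show ?thesis by (rule AE_I') (auto simp: not_less)
    qed
    then show ?thesis by eventually_elim (metis of_nat_0_less_iff zero_less_Suc)
  qed
  then have "AE \<omega> in M. \<forall>m :: nat. \<exists>s>0. real m < V s \<omega>" by (simp add: AE_all_countable)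
  then show ?thesis
    by eventually_elim (meson less_le_trans less_imp_le reals_Archimedean2 le_less_trans)
qed

text \<open>The Chernoff bound at level 0 is exp (- h * \<xi> powr \<alpha>), which vanishes as
  \<xi> grows.\<close>

lemma AE_V_pos:
  assumes "0 < h"
  shows "AE \<omega> in M. 0 < V h \<omega>"
proof -
  have [measurable]: "V h \<in> borel_measurable M" using assms by (intro V_measurable) auto
  have "((\<lambda>\<xi>. exp (- (h * \<xi> powr \<alpha>))) \<longlongrightarrow> 0) at_top"
    using assms \<alpha>(1) by real_asymp
  moreover have "\<forall>\<^sub>F \<xi> in at_top. prob {\<omega> \<in> space M. V h \<omega> \<le> 0} \<le> exp (- (h * \<xi> powr \<alpha>))"
    using eventually_gt_at_top[of 0] by eventually_elim (use prob_V_le[of h _ 0] assms in auto)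
  ultimately have "prob {\<omega> \<in> space M. V h \<omega> \<le> 0} \<le> 0"
    by (rule tendsto_lowerbound) auto
  then have "{\<omega> \<in> space M. V h \<omega> \<le> 0} \<in> null_sets M"
    by (auto simp: null_sets_def emeasure_eq_measure measure_le_0_iff)
  then show ?thesis by (rule AE_I') (auto simp: not_less)
qed

text \<open>Stationarity gives V s - V r the law of V (s - r), which is almost surely positive.
  Countably many rational pairs share one null set, and two rationals between r and s together with
  monotonicity extend the inequality to all real pairs.\<close>

lemma AE_V_strict_mono: "AE \<omega> in M. \<forall>r s. 0 \<le> r \<longrightarrow> r < s \<longrightarrow> V r \<omega> < V s \<omega>"
proof -
  have inc: "AE \<omega> in M. V r \<omega> < V s \<omega>" if "0 \<le> r" "r < s" for r s
  proof -
    have [measurable]: "V r \<in> borel_measurable M" "V s \<in> borel_measurable M" "V (s - r) \<in> borel_measurable M"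
      using that by (auto intro!: V_measurable)
    have "AE x in distr M borel (V (s - r)). 0 < x"
      using AE_V_pos[of "s - r"] that by (subst AE_distr_iff) auto
    also have "distr M borel (V (s - r)) = distr M borel (\<lambda>\<omega>. V s \<omega> - V r \<omega>)"
      using subordinator that by (simp add: stable_subordinator_def)
    finally show ?thesis by (subst (asm) AE_distr_iff) auto
  qed
  have "AE \<omega> in M. \<forall>p\<in>\<rat> \<times> \<rat>. 0 \<le> fst p \<longrightarrow> fst p < snd p \<longrightarrow> V (fst p) \<omega> < V (snd p) \<omega>"
    using inc by (subst AE_ball_countable) (auto intro!: countable_SIGMA countable_rat)
  then show ?thesis using AE_space
  proof eventually_elim
    case (elim \<omega>)
    show ?case
    proof (intro allI impI)
      fix r s :: real assume rs: "0 \<le> r" "r < s"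
      obtain p where p: "p \<in> \<rat>" "r < p" "p < s" using Rats_dense_in_real[OF rs(2)] by blast
      obtain q where q: "q \<in> \<rat>" "p < q" "q < s" using Rats_dense_in_real[OF p(3)] by blast
      have "V r \<omega> \<le> V p \<omega>" "V q \<omega> \<le> V s \<omega>" using elim(2) rs p q by (auto intro!: V_mono')
      moreover have "V p \<omega> < V q \<omega>" using elim(1) p q rs by fastforce
      ultimately show "V r \<omega> < V s \<omega>" by simp
    qed
  qed
qed

section \<open>Measurability of the inverse and of the subordinator\<close>

abbreviation E :: "real \<Rightarrow> 'a \<Rightarrow> real" where "E \<equiv> inverse_subordinator V"

text \<open>By monotonicity the r witnessing E t < a can be moved up to a rational below a, so the
  event is a countable union of events t < V r. Paths bounded by t are treated separately: there E t
  = 0, which is below a exactly when 0 < a.\<close>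

lemma E_measurable [measurable]: "E t \<in> borel_measurable M"
  unfolding borel_measurable_iff_less
proof
  fix a
  have V: "{\<omega> \<in> space M. t < V r \<omega>} \<in> sets M" if "0 < r" for r
  proof -
    have [measurable]: "V r \<in> borel_measurable M" using that by (intro V_measurable) auto
    show ?thesis by measurable
  qed
  define U where "U = (\<lambda>a. \<Union>r\<in>{r\<in>\<rat>. 0 < r \<and> r < a}. {\<omega> \<in> space M. t < V r \<omega>})"
  define U' where "U' = (\<Union>r\<in>{r\<in>\<rat>. 0 < r}. {\<omega> \<in> space M. t < V r \<omega>})"
  have count: "countable {r\<in>\<rat>. 0 < r \<and> r < a}" "countable {r\<in>\<rat>. 0 < (r::real)}" for a :: real
    by (auto intro: countable_subset[OF _ countable_rat])
  have U: "U a \<in> sets M" "U' \<in> sets M" unfolding U_def U'_def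
    using V count by (auto intro!: sets.countable_UN')
  have rat: "\<exists>q\<in>\<rat>. 0 < q \<and> q < b \<and> t < V q \<omega>" if "0 < r" "r < b" "t < V r \<omega>" "\<omega> \<in> space M" for r b \<omega>
  proof -
    obtain q where "q \<in> \<rat>" "r < q" "q < b" using Rats_dense_in_real[OF \<open>r < b\<close>] by blast
    then show ?thesis using V_mono'[of \<omega> r q] that by (intro bexI[of _ q]) auto
  qed
  have "{\<omega> \<in> space M. E t \<omega> < a} = U a \<union> (if 0 < a then space M - U' else {})"
  proof (intro set_eqI)
    fix \<omega>
    show "\<omega> \<in> {\<omega> \<in> space M. E t \<omega> < a} \<longleftrightarrow> \<omega> \<in> U a \<union> (if 0 < a then space M - U' else {})"
    proof (cases "\<omega> \<in> space M \<and> (\<exists>r>0. t < V r \<omega>)")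
      case True
      then obtain r where r: "0 < r" "t < V r \<omega>" by blast
      have "\<omega> \<in> U'" using rat[of r "r + 1" \<omega>] r True by (auto simp: U'_def)
      moreover have "\<omega> \<in> U a \<longleftrightarrow> (\<exists>r>0. r < a \<and> t < V r \<omega>)"
        using rat[of _ a \<omega>] True by (auto simp: U_def)
      ultimately show ?thesis
        using inverse_subordinator_less_iff[of t V \<omega> a] True by auto
    next
      case False
      then have "\<omega> \<in> space M \<Longrightarrow> E t \<omega> = 0" by (auto simp: inverse_subordinator_def)
      then show ?thesis using False by (auto simp: U_def U'_def)
    qed
  qed
  then show "{\<omega> \<in> space M. E t \<omega> < a} \<in> sets M" using U by auto
qed

text \<open>The truncation at 0 makes the subordinator jointly measurable on the whole line.\<close>

definition W :: "real \<Rightarrow> 'a \<Rightarrow> real" where "W s \<omega> = V (max 0 s) \<omega>"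

text \<open>Right continuity and monotonicity write the set where W < a as the union over positive
  rationals r of the rectangles s < r, V r < a.\<close>

lemma W_measurable [measurable]: "case_prod W \<in> borel_measurable (borel \<Otimes>\<^sub>M M)"
  unfolding borel_measurable_iff_less
proof
  fix a
  have V: "{\<omega> \<in> space M. V r \<omega> < a} \<in> sets M" if "0 < r" for r
  proof -
    have [measurable]: "V r \<in> borel_measurable M" using that by (intro V_measurable) auto
    show ?thesis by measurable
  qed
  have "{w \<in> space (borel \<Otimes>\<^sub>M M). case_prod W w < a} =
      (\<Union>r\<in>{r\<in>\<rat>. 0 < r}. {..<r} \<times> {\<omega> \<in> space M. V r \<omega> < a})" (is "?L = ?R")
  proof (intro set_eqI iffI)
    fix w assume "w \<in> ?L"
    then obtain s \<omega> where w: "w = (s, \<omega>)" "\<omega> \<in> space M" "V (max 0 s) \<omega> < a"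
      by (auto simp: space_pair_measure W_def)
    have "\<forall>\<^sub>F r in at_right (max 0 s). V r \<omega> < a"
      using V_right_continuous[of \<omega> "max 0 s"] w
      by (auto simp: continuous_within intro: order_tendstoD)
    then obtain b where b: "max 0 s < b" "\<And>r. max 0 s < r \<Longrightarrow> r < b \<Longrightarrow> V r \<omega> < a"
      unfolding eventually_at_right_field by blast
    obtain q where "q \<in> \<rat>" "max 0 s < q" "q < b" using Rats_dense_in_real[OF b(1)] by blast
    then show "w \<in> ?R" using b(2)[of q] w by auto
  next
    fix w assume "w \<in> ?R"
    then obtain r s \<omega> where "0 < r" "s < r" "\<omega> \<in> space M" "V r \<omega> < a" "w = (s, \<omega>)" by auto
    then show "w \<in> ?L" using V_mono'[of \<omega> "max 0 s" r] by (auto simp: space_pair_measure W_def)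
  qed
  moreover have "?R \<in> sets (borel \<Otimes>\<^sub>M M)"
    using V countable_rat by (intro sets.countable_UN') (auto intro: countable_subset[OF _ countable_rat])
  ultimately show "{w \<in> space (borel \<Otimes>\<^sub>M M). case_prod W w < a} \<in> sets (borel \<Otimes>\<^sub>M M)" by simp
qed

lemma AE_W: "AE \<omega> in M. \<forall>s. 0 \<le> W s \<omega>"
  using AE_V_nonneg by eventually_elim (auto simp: W_def)

text \<open>Up to the single point s = E t, the events s < E t and V s \<le> t agree.\<close>

lemma power_E_eq_nn_integral:
  assumes "0 \<le> t"
  shows "AE \<omega> in M. ennreal (E t \<omega> ^ Suc m) =
    (\<integral>\<^sup>+s. ennreal (indicator {0..} s * (real (Suc m) * s ^ m)) * indicator {..t} (W s \<omega>) \<partial>lborel)"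
  using AE_V_unbounded AE_space
proof eventually_elim
  case (elim \<omega>)
  have iff: "V s \<omega> \<le> t \<longleftrightarrow> s \<le> E t \<omega>" if "0 < s" "s \<noteq> E t \<omega>" for s
    using inverse_subordinator_le[of s t V \<omega>] inverse_subordinator_ge[of V \<omega> t s, OF V_mono[OF elim(2)]] elim(1) that
    by (meson less_le_not_le linorder_not_le order_less_le)
  have "ennreal (E t \<omega> ^ Suc m) = (\<integral>\<^sup>+s. ennreal (real (Suc m) * s ^ m) * indicator {0..E t \<omega>} s \<partial>lborel)"
    by (rule nn_integral_power_Icc[OF inverse_subordinator_nonneg, symmetric])
  also have "\<dots> = (\<integral>\<^sup>+s. ennreal (indicator {0..} s * (real (Suc m) * s ^ m)) * indicator {..t} (W s \<omega>) \<partial>lborel)"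
  proof (rule nn_integral_cong_AE)
    have "AE s in lborel. s \<noteq> 0" "AE s in lborel. s \<noteq> E t \<omega>" by (rule AE_lborel_singleton)+
    then show "AE s in lborel. ennreal (real (Suc m) * s ^ m) * indicator {0..E t \<omega>} s =
        ennreal (indicator {0..} s * (real (Suc m) * s ^ m)) * indicator {..t} (W s \<omega>)"
    proof eventually_elim
      case (elim s)
      show ?case using iff[of s] elim by (cases "0 < s") (auto simp: indicator_def W_def)
    qed
  qed
  finally show ?case .
qed

section \<open>Moments of the inverse and their Laplace transforms\<close>

lemma pair_lborel_M: "pair_sigma_finite lborel M"
  by unfold_locales

lemma nn_integral_V_tail_power:
  assumes "0 < \<xi>" "0 \<le> c"
  shows "(\<integral>\<^sup>+s. ennreal (indicator {0..} s * (real (Suc m) * s ^ m)) * ennreal (c * exp (- s * \<xi> powr \<alpha>)) \<partial>lborel) =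
    ennreal (c * (fact (Suc m) / (\<xi> powr \<alpha>) ^ Suc m))"
proof -
  have "ennreal (indicator {0..} s * (real (Suc m) * s ^ m)) * ennreal (c * exp (- s * \<xi> powr \<alpha>)) =
      ennreal (c * real (Suc m)) * ennreal (indicator {0..} s * s ^ m * exp (- s * \<xi> powr \<alpha>))" for s
    using assms by (cases "0 \<le> s") (simp_all add: ennreal_mult'[symmetric] mult_ac)
  then have "(\<integral>\<^sup>+s. ennreal (indicator {0..} s * (real (Suc m) * s ^ m)) * ennreal (c * exp (- s * \<xi> powr \<alpha>)) \<partial>lborel) =
      ennreal (c * real (Suc m)) * ennreal (fact m / (\<xi> powr \<alpha>) ^ Suc m)"
    using nn_integral_power_exp[of "\<xi> powr \<alpha>" m] assms by (simp add: nn_integral_cmult)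
  then show ?thesis using assms by (simp add: ennreal_mult'[symmetric] mult_ac)
qed

text \<open>Tonelli's theorem for the layer-cake formula: only the one-dimensional laws of V remain,
  through the probabilities of V s \<le> t.\<close>

lemma nn_integral_power_E:
  assumes "0 \<le> t"
  shows "(\<integral>\<^sup>+\<omega>. ennreal (E t \<omega> ^ Suc m) \<partial>M) =
    (\<integral>\<^sup>+s. ennreal (indicator {0..} s * (real (Suc m) * s ^ m)) * (\<integral>\<^sup>+\<omega>. indicator {..t} (W s \<omega>) \<partial>M) \<partial>lborel)"
proof -
  interpret P: pair_sigma_finite lborel M by (rule pair_lborel_M)
  have "(\<integral>\<^sup>+\<omega>. ennreal (E t \<omega> ^ Suc m) \<partial>M) =
      (\<integral>\<^sup>+\<omega>. \<integral>\<^sup>+s. ennreal (indicator {0..} s * (real (Suc m) * s ^ m)) * indicator {..t} (W s \<omega>) \<partial>lborel \<partial>M)"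
    using power_E_eq_nn_integral[OF assms] by (intro nn_integral_cong_AE) auto
  also have "\<dots> = (\<integral>\<^sup>+s. \<integral>\<^sup>+\<omega>. ennreal (indicator {0..} s * (real (Suc m) * s ^ m)) * indicator {..t} (W s \<omega>) \<partial>M \<partial>lborel)"
    by (rule P.Fubini') measurable
  also have "\<dots> = (\<integral>\<^sup>+s. ennreal (indicator {0..} s * (real (Suc m) * s ^ m)) * (\<integral>\<^sup>+\<omega>. indicator {..t} (W s \<omega>) \<partial>M) \<partial>lborel)"
    by (intro nn_integral_cong nn_integral_cmult) measurable
  finally show ?thesis .
qed

text \<open>The Chernoff bound at \<xi> = 1 replaces the probability of V s \<le> t by exp (t - s).
  This yields finite moments and the growth of order exp t that \<open>Laplace_unique\<close>
  admits.\<close>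

lemma nn_integral_power_E_le:
  assumes "0 \<le> t"
  shows "(\<integral>\<^sup>+\<omega>. ennreal (E t \<omega> ^ Suc m) \<partial>M) \<le> ennreal (fact (Suc m) * exp t)"
proof -
  have "(\<integral>\<^sup>+\<omega>. ennreal (E t \<omega> ^ Suc m) \<partial>M) \<le>
    (\<integral>\<^sup>+s. ennreal (indicator {0..} s * (real (Suc m) * s ^ m)) * ennreal (exp t * exp (- s * 1 powr \<alpha>)) \<partial>lborel)"
    unfolding nn_integral_power_E[OF assms]
  proof (rule nn_integral_mono)
    fix s :: real
    show "ennreal (indicator {0..} s * (real (Suc m) * s ^ m)) * (\<integral>\<^sup>+\<omega>. indicator {..t} (W s \<omega>) \<partial>M) \<le>
      ennreal (indicator {0..} s * (real (Suc m) * s ^ m)) * ennreal (exp t * exp (- s * 1 powr \<alpha>))"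
      using V_tail[of s 1 t] by (cases "0 \<le> s") (auto simp: W_def exp_diff exp_minus divide_inverse intro!: mult_left_mono)
  qed
  also have "\<dots> = ennreal (exp t * (fact (Suc m) / (1 powr \<alpha>) ^ Suc m))"
    by (rule nn_integral_V_tail_power) auto
  finally show ?thesis by (simp add: mult.commute)
qed

text \<open>With t integrated before s, the inner integral becomes the expectation of exp (- \<xi> V
  s) / \<xi>, that is, exp (- s * \<xi> powr \<alpha>) / \<xi>; the remaining integral over s is of
  Gamma type.\<close>

lemma Laplace_power_E:
  assumes "0 < \<xi>"
  shows "(\<integral>\<^sup>+t. ennreal (indicator {0..} t * exp (- \<xi> * t)) * (\<integral>\<^sup>+\<omega>. ennreal (E t \<omega> ^ Suc m) \<partial>M) \<partial>lborel) =
    ennreal (fact (Suc m) / (\<xi> * (\<xi> powr \<alpha>) ^ Suc m))"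
proof -
  interpret P: pair_sigma_finite lborel M by (rule pair_lborel_M)
  let ?e = "\<lambda>t. ennreal (indicator {0..} t * exp (- \<xi> * t))"
  let ?D = "\<lambda>s. ennreal (indicator {0..} s * (real (Suc m) * s ^ m))"
  let ?G = "\<lambda>s t. \<integral>\<^sup>+\<omega>. indicator {..t} (W s \<omega>) \<partial>M"
  \<comment> \<open>Written as a conditional, the indicator is a comparison of
    \<open>W s \<omega>\<close> with t, jointly measurable in all variables.\<close>
  have ind: "(indicator {..t} (W s \<omega>) :: ennreal) = (if W s \<omega> \<le> t then 1 else 0)" for s t \<omega>
    by (simp add: indicator_def)
  have [measurable]: "(\<lambda>(s, t). ?G s t) \<in> borel_measurable (lborel \<Otimes>\<^sub>M lborel)"
    unfolding ind by measurable
  have "(\<integral>\<^sup>+t. ?e t * (\<integral>\<^sup>+\<omega>. ennreal (E t \<omega> ^ Suc m) \<partial>M) \<partial>lborel) =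
      (\<integral>\<^sup>+t. \<integral>\<^sup>+s. ?e t * (?D s * ?G s t) \<partial>lborel \<partial>lborel)"
  proof (rule nn_integral_cong)
    fix t :: real
    show "?e t * (\<integral>\<^sup>+\<omega>. ennreal (E t \<omega> ^ Suc m) \<partial>M) = (\<integral>\<^sup>+s. ?e t * (?D s * ?G s t) \<partial>lborel)"
      by (cases "0 \<le> t") (simp_all add: nn_integral_power_E nn_integral_cmult del: power_Suc of_nat_Suc)
  qed
  also have "\<dots> = (\<integral>\<^sup>+s. \<integral>\<^sup>+t. ?e t * (?D s * ?G s t) \<partial>lborel \<partial>lborel)"
    by (rule lborel_pair.Fubini') measurable
  also have "\<dots> = (\<integral>\<^sup>+s. ?D s * ennreal (1 / \<xi> * exp (- s * \<xi> powr \<alpha>)) \<partial>lborel)"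
  proof (rule nn_integral_cong)
    fix s :: real
    show "(\<integral>\<^sup>+t. ?e t * (?D s * ?G s t) \<partial>lborel) = ?D s * ennreal (1 / \<xi> * exp (- s * \<xi> powr \<alpha>))"
    proof (cases "0 \<le> s")
      case True
      have "(\<integral>\<^sup>+t. ?e t * (?D s * ?G s t) \<partial>lborel) = (\<integral>\<^sup>+t. ?D s * (?e t * ?G s t) \<partial>lborel)"
        by (simp only: mult.left_commute)
      also have "\<dots> = ?D s * (\<integral>\<^sup>+t. ?e t * ?G s t \<partial>lborel)"
        by (rule nn_integral_cmult) measurable
      also have "(\<integral>\<^sup>+t. ?e t * ?G s t \<partial>lborel) = (\<integral>\<^sup>+t. \<integral>\<^sup>+\<omega>. ?e t * indicator {..t} (W s \<omega>) \<partial>M \<partial>lborel)"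
        by (intro nn_integral_cong nn_integral_cmult[symmetric]) measurable
      also have "\<dots> = (\<integral>\<^sup>+\<omega>. \<integral>\<^sup>+t. ?e t * indicator {..t} (W s \<omega>) \<partial>lborel \<partial>M)"
        unfolding ind by (rule P.Fubini'[symmetric]) measurable
      also have "\<dots> = (\<integral>\<^sup>+\<omega>. ennreal (1 / \<xi>) * ennreal (exp (- \<xi> * V s \<omega>)) \<partial>M)"
      proof (rule nn_integral_cong_AE)
        show "AE \<omega> in M. (\<integral>\<^sup>+t. ?e t * indicator {..t} (W s \<omega>) \<partial>lborel) =
            ennreal (1 / \<xi>) * ennreal (exp (- \<xi> * V s \<omega>))"
          using AE_W
        proof eventually_elim
          case (elim \<omega>)
          have "(indicator {..t} (W s \<omega>) :: ennreal) = indicator {W s \<omega>..} t" for t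
            by (simp add: indicator_def)
          then show ?case
            using nn_integral_exp_tail[OF assms, of "W s \<omega>"] spec[OF elim, of s] True assms
            by (simp add: W_def ennreal_mult'[symmetric])
        qed
      qed
      also have "\<dots> = ennreal (1 / \<xi>) * ennreal (exp (- s * \<xi> powr \<alpha>))"
        using V_measurable[OF True] by (subst nn_integral_cmult) (simp_all only: V_Laplace[OF True assms], measurable)
      finally show ?thesis using assms by (simp add: ennreal_mult'[symmetric])
    qed simp
  qed
  also have "\<dots> = ennreal (1 / \<xi> * (fact (Suc m) / (\<xi> powr \<alpha>) ^ Suc m))"
    using assms by (intro nn_integral_V_tail_power) auto
  finally show ?thesis by simp
qed

lemma integrable_power_E: "0 \<le> t \<Longrightarrow> integrable M (\<lambda>\<omega>. E t \<omega> ^ n)"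
proof (cases n)
  case (Suc m)
  assume "0 \<le> t"
  then have "(\<integral>\<^sup>+\<omega>. ennreal (E t \<omega> ^ Suc m) \<partial>M) < \<infinity>"
    using nn_integral_power_E_le[of t m] by (auto intro: le_less_trans)
  then show ?thesis unfolding Suc
    by (intro integrableI_nonneg) (auto simp: inverse_subordinator_nonneg)
qed simp

text \<open>Dominated convergence along sequences: almost every path of E is continuous and
  nondecreasing, so the n-th power of E T dominates when T bounds the sequence of times.\<close>

lemma continuous_moment: "continuous_on {0..} (\<lambda>t. expectation (\<lambda>\<omega>. E t \<omega> ^ n))"
  unfolding continuous_on_sequentially
proof (intro allI ballI impI)
  fix x :: "nat \<Rightarrow> real" and a :: real
  assume x: "(\<forall>j. x j \<in> {0..}) \<and> x \<longlonglongrightarrow> a"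
  then obtain T where T: "\<And>j. x j \<le> T"
    using convergent_imp_Bseq[of x] by (auto simp: convergent_def Bseq_def abs_le_iff)
  have T0: "0 \<le> T" using T[of 0] x by (auto intro: order_trans)
  show "((\<lambda>t. expectation (\<lambda>\<omega>. E t \<omega> ^ n)) \<circ> x) \<longlonglongrightarrow> expectation (\<lambda>\<omega>. E a \<omega> ^ n)"
    unfolding comp_def
  proof (rule integral_dominated_convergence[where w = "\<lambda>\<omega>. E T \<omega> ^ n"])
    show "AE \<omega> in M. (\<lambda>j. E (x j) \<omega> ^ n) \<longlonglongrightarrow> E a \<omega> ^ n"
      using AE_V_unbounded AE_V_strict_mono AE_space
    proof eventually_elim
      case (elim \<omega>)
      have "isCont (\<lambda>t. E t \<omega>) a"
        by (rule inverse_subordinator_continuous[of V \<omega>, OF V_mono[OF elim(3)]]) (use elim in blast)+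
      then have "(\<lambda>j. E (x j) \<omega>) \<longlonglongrightarrow> E a \<omega>"
        by (rule isCont_tendsto_compose[where g = "\<lambda>t. E t \<omega>", OF _ conjunct2[OF x]])
      then show ?case by (rule tendsto_power)
    qed
    show "AE \<omega> in M. norm (E (x j) \<omega> ^ n) \<le> E T \<omega> ^ n" for j
      using AE_V_unbounded
    proof eventually_elim
      case (elim \<omega>)
      then have "E (x j) \<omega> \<le> E T \<omega>" by (intro inverse_subordinator_mono T) auto
      then show ?case by (auto simp: inverse_subordinator_nonneg intro!: power_mono)
    qed
  qed (use T0 integrable_power_E in auto)
qed

text \<open>For n > 0 both sides are continuous in t, bounded by fact n * exp t, and have the
  transform fact n / (\<xi> * (\<xi> powr \<alpha>) ^ n). Order 0 is separate because the layer-cake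
  formula starts at the first power.\<close>

lemma moment_E:
  assumes "0 \<le> t"
  shows "expectation (\<lambda>\<omega>. E t \<omega> ^ n) = fact n / Gamma (\<alpha> * real n + 1) * (t powr \<alpha>) ^ n"
proof (cases n)
  case 0
  then show ?thesis by (simp add: prob_space)
next
  case n: (Suc m)
  have pos: "0 < Gamma (\<alpha> * real n + 1)" using \<alpha> by (intro Gamma_real_pos add_nonneg_pos) auto
  let ?m = "\<lambda>t. expectation (\<lambda>\<omega>. E t \<omega> ^ n)"
  have nn: "(\<integral>\<^sup>+\<omega>. ennreal (E t \<omega> ^ n) \<partial>M) = ennreal (?m t)" if "0 \<le> t" for t
    using integrable_power_E[OF that] by (intro nn_integral_eq_integral) (auto simp: inverse_subordinator_nonneg)
  have m0: "0 \<le> ?m t" for t by (auto simp: inverse_subordinator_nonneg)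
  show ?thesis
  proof (rule Laplace_unique[where g = "\<lambda>t. fact n / Gamma (\<alpha> * real n + 1) * (t powr \<alpha>) ^ n"])
    show "continuous_on {0..} ?m" by (rule continuous_moment)
    have "continuous_on {0..} (\<lambda>t::real. t powr \<alpha>)"
      using \<alpha> by (intro continuous_on_powr') (auto intro!: continuous_intros)
    then show "continuous_on {0..} (\<lambda>t. fact n / Gamma (\<alpha> * real n + 1) * (t powr \<alpha>) ^ n)"
      by (intro continuous_on_mult continuous_on_const continuous_on_power)
    show "\<bar>?m t\<bar> \<le> fact n * exp t" if "0 \<le> t" for t
    proof -
      have "ennreal (?m t) \<le> ennreal (fact n * exp t)"
        using nn_integral_power_E_le[OF that, of m] nn[OF that] by (simp add: n)
      then show ?thesis using m0[of t] by (subst (asm) ennreal_le_iff) auto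
    qed
    show "\<bar>fact n / Gamma (\<alpha> * real n + 1) * (t powr \<alpha>) ^ n\<bar> \<le> fact n * exp t" if "0 \<le> t" for t
    proof (cases "t = 0")
      case False
      with that have t: "0 < t" by simp
      have "(t powr \<alpha>) ^ n = t powr (\<alpha> * real n)"
        using t by (simp add: powr_powr[symmetric] powr_realpow)
      moreover have "t powr (\<alpha> * real n) * exp (- t) \<le> Gamma (\<alpha> * real n + 1)"
        using \<alpha> t by (intro Gamma_plus1_ge) auto
      then have "t powr (\<alpha> * real n) \<le> exp t * Gamma (\<alpha> * real n + 1)"
        by (simp add: exp_minus field_simps)
      ultimately have "(t powr \<alpha>) ^ n / Gamma (\<alpha> * real n + 1) \<le> exp t"
        using pos by (simp add: pos_divide_le_eq)
      then have "fact n * ((t powr \<alpha>) ^ n / Gamma (\<alpha> * real n + 1)) \<le> fact n * exp t"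
        by (rule mult_left_mono) auto
      then show ?thesis using pos by (simp add: abs_mult abs_of_pos)
    qed (simp add: n)
    show "(LBINT t:{0..}. exp (- real j * t) * ?m t) =
        (LBINT t:{0..}. exp (- real j * t) * (fact n / Gamma (\<alpha> * real n + 1) * (t powr \<alpha>) ^ n))"
      if "2 \<le> j" for j :: nat
    proof -
      have j: "0 < real j" using that by simp
      let ?f = "\<lambda>t. indicator {0..} t *\<^sub>R (exp (- real j * t) * ?m t)"
      have "integral\<^sup>L lborel ?f = enn2real (\<integral>\<^sup>+t. ennreal (?f t) \<partial>lborel)"
      proof (rule integral_eq_nn_integral)
        have "(\<lambda>t. indicator {0..} t *\<^sub>R (exp (- real j * t) * ?m t)) \<in> borel_measurable borel"
          by (intro borel_measurable_continuous_on_indicator continuous_intros continuous_moment) auto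
        then show "?f \<in> borel_measurable lborel" by simp
      qed (use m0 in auto)
      also have "(\<integral>\<^sup>+t. ennreal (?f t) \<partial>lborel) =
          (\<integral>\<^sup>+t. ennreal (indicator {0..} t * exp (- real j * t)) * (\<integral>\<^sup>+\<omega>. ennreal (E t \<omega> ^ Suc m) \<partial>M) \<partial>lborel)"
      proof (rule nn_integral_cong)
        fix t :: real
        show "ennreal (?f t) = ennreal (indicator {0..} t * exp (- real j * t)) * (\<integral>\<^sup>+\<omega>. ennreal (E t \<omega> ^ Suc m) \<partial>M)"
          using nn[of t] m0[of t] by (cases "0 \<le> t") (simp_all add: n ennreal_mult'[symmetric])
      qed
      also have "\<dots> = ennreal (fact n / (real j * (real j powr \<alpha>) ^ n))"
        unfolding n by (rule Laplace_power_E[OF j])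
      finally have "(LBINT t:{0..}. exp (- real j * t) * ?m t) = fact n / (real j * (real j powr \<alpha>) ^ n)"
        using j by (simp add: set_lebesgue_integral_def)
      moreover have "(LBINT t:{0..}. exp (- real j * t) * (fact n / Gamma (\<alpha> * real n + 1) * (t powr \<alpha>) ^ n)) =
          fact n / Gamma (\<alpha> * real n + 1) * (LBINT t:{0..}. exp (- real j * t) * (t powr \<alpha>) ^ n)"
        by (subst set_integral_mult_right[symmetric]) (simp add: mult.left_commute)
      ultimately show ?thesis
        using Laplace_powr[OF \<alpha>(1) j, of n] pos by simp
    qed
  qed (rule assms)
qed

end

section \<open>The time change\<close>

text \<open>Splitting by the value of J replaces a random index by fixed ones, the form in which
  independence can be used.\<close>

lemma nn_integral_countable_choice:
  fixes J :: "'a \<Rightarrow> nat" and X :: "nat \<Rightarrow> 'a \<Rightarrow> ennreal"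
  assumes [measurable]: "J \<in> measurable M (count_space UNIV)" "\<And>j. X j \<in> borel_measurable M"
  shows "(\<integral>\<^sup>+\<omega>. X (J \<omega>) \<omega> \<partial>M) = (\<Sum>j. \<integral>\<^sup>+\<omega>. indicator {\<omega> \<in> space M. J \<omega> = j} \<omega> * X j \<omega> \<partial>M)"
proof -
  have "(\<integral>\<^sup>+\<omega>. X (J \<omega>) \<omega> \<partial>M) = (\<integral>\<^sup>+\<omega>. (\<Sum>j. indicator {\<omega> \<in> space M. J \<omega> = j} \<omega> * X j \<omega>) \<partial>M)"
  proof (rule nn_integral_cong)
    fix \<omega> assume "\<omega> \<in> space M"
    then have "(\<lambda>j. indicator {\<omega> \<in> space M. J \<omega> = j} \<omega> * X j \<omega>) = (\<lambda>j. if j = J \<omega> then X j \<omega> else 0)"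
      by (auto simp: indicator_def)
    then show "X (J \<omega>) \<omega> = (\<Sum>j. indicator {\<omega> \<in> space M. J \<omega> = j} \<omega> * X j \<omega>)"
      using sums_unique[OF sums_single[of "J \<omega>" "\<lambda>j. X j \<omega>"]] by simp
  qed
  also have "\<dots> = (\<Sum>j. \<integral>\<^sup>+\<omega>. indicator {\<omega> \<in> space M. J \<omega> = j} \<omega> * X j \<omega> \<partial>M)"
    by (rule nn_integral_suminf) measurable
  finally show ?thesis .
qed

text \<open>
  The random time is approximated from the right by the lattice-valued times
  (floor (n T) + 1) / n, so that right continuity of the paths applies.
\<close>

lemma (in prob_space) prob_independent_time_change:
  fixes N :: "real \<Rightarrow> 'a \<Rightarrow> nat" and T :: "'a \<Rightarrow> real"
  assumes N: "\<And>s. 0 \<le> s \<Longrightarrow> N s \<in> measurable M (count_space UNIV)"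
    and right_cont: "\<And>\<omega> s. \<omega> \<in> space M \<Longrightarrow> 0 \<le> s \<Longrightarrow> continuous (at_right s) (\<lambda>s. N s \<omega>)"
    and T [measurable]: "T \<in> borel_measurable M" and T_nonneg: "\<And>\<omega>. 0 \<le> T \<omega>"
    and indep: "\<And>s A k. 0 \<le> s \<Longrightarrow> A \<in> sets borel \<Longrightarrow>
      prob ({\<omega> \<in> space M. T \<omega> \<in> A} \<inter> {\<omega> \<in> space M. N s \<omega> = k}) =
      prob {\<omega> \<in> space M. T \<omega> \<in> A} * prob {\<omega> \<in> space M. N s \<omega> = k}"
    and cont: "continuous_on {0..} (\<lambda>s. prob {\<omega> \<in> space M. N s \<omega> = k})"
  shows "{\<omega> \<in> space M. N (T \<omega>) \<omega> = k} \<in> sets M"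
    and "prob {\<omega> \<in> space M. N (T \<omega>) \<omega> = k} = expectation (\<lambda>\<omega>. prob {\<omega>' \<in> space M. N (T \<omega>) \<omega>' = k})"
proof -
  define p where "p = (\<lambda>s. prob {\<omega> \<in> space M. N s \<omega> = k})"
  \<comment> \<open>Lattice points of mesh 1 / Suc n. The added 1 places the approximation strictly
    to the right of T, as \<open>at_right\<close> excludes the point itself.\<close>
  define \<tau> where "\<tau> = (\<lambda>n j. (real j + 1) / real (Suc n))"
  define J where "J = (\<lambda>n \<omega>. nat \<lfloor>real (Suc n) * T \<omega>\<rfloor>)"
  define S where "S = (\<lambda>n \<omega>. \<tau> n (J n \<omega>))"
  define f where "f = (\<lambda>s \<omega>. if N s \<omega> = k then 1 else 0 :: real)"
  have \<tau>: "0 \<le> \<tau> n j" for n j by (simp add: \<tau>_def)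
  have J [measurable]: "J n \<in> measurable M (count_space UNIV)" for n unfolding J_def by measurable
  have f_meas: "f s \<in> borel_measurable M" if "0 \<le> s" for s
  proof -
    have [measurable]: "N s \<in> measurable M (count_space UNIV)" using that by (rule N)
    show ?thesis unfolding f_def by measurable
  qed
  have S_bounds: "T \<omega> < S n \<omega> \<and> S n \<omega> \<le> T \<omega> + 1 / real (Suc n)" for n \<omega>
  proof -
    have "real (J n \<omega>) \<le> real (Suc n) * T \<omega>" "real (Suc n) * T \<omega> < real (J n \<omega>) + 1"
      using T_nonneg[of \<omega>] by (auto simp: J_def)
    then show ?thesis by (simp add: S_def \<tau>_def field_simps del: of_nat_Suc)
  qed
  have S_lim: "filterlim (\<lambda>n. S n \<omega>) (at_right (T \<omega>)) sequentially" for \<omega>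
  proof -
    have "(\<lambda>n. T \<omega> + 1 / real (Suc n)) \<longlonglongrightarrow> T \<omega> + 0"
      by (intro tendsto_intros LIMSEQ_Suc[OF lim_1_over_n])
    then have "(\<lambda>n. S n \<omega>) \<longlonglongrightarrow> T \<omega>"
      using S_bounds by (intro tendsto_sandwich[of "\<lambda>_. T \<omega>" "\<lambda>n. S n \<omega>" sequentially "\<lambda>n. T \<omega> + 1 / real (Suc n)"])
        (auto intro!: always_eventually less_imp_le)
    then show ?thesis
      using conjunct1[OF S_bounds] by (auto simp: filterlim_at less_imp_neq[symmetric] intro!: always_eventually)
  qed
  have f_lim: "(\<lambda>n. f (S n \<omega>) \<omega>) \<longlonglongrightarrow> f (T \<omega>) \<omega>" if "\<omega> \<in> space M" for \<omega>
  proof -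
    \<comment> \<open>The state space is discrete, so a right limit means that the path is constant
      immediately to the right of T, and the approximating times eventually fall into that
      interval.\<close>
    have "((\<lambda>s. N s \<omega>) \<longlongrightarrow> N (T \<omega>) \<omega>) (at_right (T \<omega>))"
      using right_cont[OF that T_nonneg] by (simp add: continuous_within)
    then have "\<forall>\<^sub>F s in at_right (T \<omega>). N s \<omega> = N (T \<omega>) \<omega>" by (simp add: tendsto_discrete)
    then have "\<forall>\<^sub>F n in sequentially. N (S n \<omega>) \<omega> = N (T \<omega>) \<omega>"
      using S_lim by (rule eventually_compose_filterlim)
    then show ?thesis by (intro tendsto_eventually) (auto simp: f_def elim!: eventually_mono)
  qed
  have fS_meas [measurable]: "(\<lambda>\<omega>. f (S n \<omega>) \<omega>) \<in> borel_measurable M" for n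
    unfolding S_def by (rule measurable_compose_countable[OF f_meas[OF \<tau>] J])
  \<comment> \<open>Measurability at the random time is inherited, as a pointwise limit, from times
    with countably many values.\<close>
  have fT_meas [measurable]: "(\<lambda>\<omega>. f (T \<omega>) \<omega>) \<in> borel_measurable M"
    by (rule borel_measurable_LIMSEQ_real[OF f_lim fS_meas])
  have "{\<omega> \<in> space M. N (T \<omega>) \<omega> = k} = {\<omega> \<in> space M. f (T \<omega>) \<omega> = 1}" by (auto simp: f_def)
  also have "\<dots> \<in> sets M" by measurable
  finally show set: "{\<omega> \<in> space M. N (T \<omega>) \<omega> = k} \<in> sets M" .
  have p_meas: "(\<lambda>\<omega>. p (S n \<omega>)) \<in> borel_measurable M" for n
    unfolding S_def by (rule measurable_compose[OF J]) auto
  have p_lim: "(\<lambda>n. p (S n \<omega>)) \<longlonglongrightarrow> p (T \<omega>)" for \<omega>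
  proof -
    have "continuous (at (T \<omega>) within {0..}) p"
      using cont T_nonneg[of \<omega>] by (auto simp: continuous_on_eq_continuous_within p_def)
    then have "(p \<longlongrightarrow> p (T \<omega>)) (at_right (T \<omega>))"
      unfolding continuous_within by (rule tendsto_within_subset) (use T_nonneg[of \<omega>] in auto)
    then show ?thesis using S_lim by (rule filterlim_compose)
  qed
  have eq: "(LINT \<omega>|M. f (S n \<omega>) \<omega>) = (LINT \<omega>|M. p (S n \<omega>))" for n
  proof -
    have "(\<integral>\<^sup>+\<omega>. ennreal (f (S n \<omega>) \<omega>) \<partial>M) = (\<integral>\<^sup>+\<omega>. ennreal (p (S n \<omega>)) \<partial>M)"
    proof -
      have "(\<integral>\<^sup>+\<omega>. indicator {\<omega> \<in> space M. J n \<omega> = j} \<omega> * ennreal (f (\<tau> n j) \<omega>) \<partial>M) =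
          (\<integral>\<^sup>+\<omega>. indicator {\<omega> \<in> space M. J n \<omega> = j} \<omega> * ennreal (p (\<tau> n j)) \<partial>M)" for j
      proof -
        let ?A = "{\<omega> \<in> space M. J n \<omega> = j}" and ?B = "{\<omega> \<in> space M. N (\<tau> n j) \<omega> = k}"
        have [measurable]: "N (\<tau> n j) \<in> measurable M (count_space UNIV)" using \<tau> by (rule N)
        \<comment> \<open>The event that J takes the value j concerns T alone, so it is independent
          of the state at the fixed time \<open>\<tau> n j\<close>.\<close>
        have A: "?A = {\<omega> \<in> space M. T \<omega> \<in> {x. nat \<lfloor>real (Suc n) * x\<rfloor> = j}}" by (simp add: J_def)
        have "{x. nat \<lfloor>real (Suc n) * x\<rfloor> = j} \<in> sets borel" by measurable
        from indep[OF \<tau> this] have ind: "prob (?A \<inter> ?B) = prob ?A * prob ?B" unfolding A .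
        have "(\<integral>\<^sup>+\<omega>. indicator ?A \<omega> * ennreal (f (\<tau> n j) \<omega>) \<partial>M) = (\<integral>\<^sup>+\<omega>. indicator (?A \<inter> ?B) \<omega> \<partial>M)"
          by (intro nn_integral_cong) (auto simp: indicator_def f_def)
        also have "\<dots> = ennreal (prob (?A \<inter> ?B))"
          by (subst nn_integral_indicator) (auto simp: emeasure_eq_measure)
        also have "\<dots> = ennreal (p (\<tau> n j)) * emeasure M ?A"
          by (simp add: ind p_def emeasure_eq_measure ennreal_mult' mult.commute)
        also have "\<dots> = (\<integral>\<^sup>+\<omega>. ennreal (p (\<tau> n j)) * indicator ?A \<omega> \<partial>M)"
          by (subst nn_integral_cmult_indicator) auto
        finally show ?thesis by (simp add: mult.commute)
      qed
      then show ?thesis unfolding S_def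
        using f_meas[OF \<tau>]
        by (simp add: nn_integral_countable_choice[OF J, where X = "\<lambda>j \<omega>. ennreal (f (\<tau> n j) \<omega>)"]
           nn_integral_countable_choice[OF J, where X = "\<lambda>j \<omega>. ennreal (p (\<tau> n j))"])
    qed
    moreover have "(LINT \<omega>|M. f (S n \<omega>) \<omega>) = enn2real (\<integral>\<^sup>+\<omega>. ennreal (f (S n \<omega>) \<omega>) \<partial>M)"
      by (rule integral_eq_nn_integral[OF fS_meas]) (simp add: f_def)
    moreover have "(LINT \<omega>|M. p (S n \<omega>)) = enn2real (\<integral>\<^sup>+\<omega>. ennreal (p (S n \<omega>)) \<partial>M)"
      by (rule integral_eq_nn_integral[OF p_meas]) (simp add: p_def)
    ultimately show ?thesis by simp
  qed
  \<comment> \<open>Both integrands are bounded by 1 and converge pointwise, one by right continuity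
    of the paths and the other by continuity of the probabilities in time.\<close>
  have "(\<lambda>n. LINT \<omega>|M. f (S n \<omega>) \<omega>) \<longlonglongrightarrow> (LINT \<omega>|M. f (T \<omega>) \<omega>)"
    by (rule integral_dominated_convergence[where w = "\<lambda>_. 1"]) (auto simp: f_lim, auto simp: f_def)
  moreover have pT_meas: "(\<lambda>\<omega>. p (T \<omega>)) \<in> borel_measurable M"
    by (rule borel_measurable_LIMSEQ_real[OF p_lim p_meas])
  have "(\<lambda>n. LINT \<omega>|M. p (S n \<omega>)) \<longlonglongrightarrow> (LINT \<omega>|M. p (T \<omega>))"
    by (rule integral_dominated_convergence[where w = "\<lambda>_. 1"])
      (use p_meas pT_meas p_lim in \<open>auto simp: p_def\<close>)
  ultimately have "(LINT \<omega>|M. f (T \<omega>) \<omega>) = (LINT \<omega>|M. p (T \<omega>))"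
    unfolding eq by (rule LIMSEQ_unique)
  moreover have "(LINT \<omega>|M. f (T \<omega>) \<omega>) = (LINT \<omega>|M. indicator {\<omega> \<in> space M. N (T \<omega>) \<omega> = k} \<omega>)"
    by (intro Bochner_Integration.integral_cong) (auto simp: f_def indicator_def)
  ultimately show "prob {\<omega> \<in> space M. N (T \<omega>) \<omega> = k} = expectation (\<lambda>\<omega>. prob {\<omega>' \<in> space M. N (T \<omega>) \<omega>' = k})"
    using set by (simp add: p_def)
qed

text \<open>Summation and expectation commute because the expectations of the absolute terms form
  the series of order \<alpha> with coefficients |c n|, which converges; the factor fact n in the
  moments cancels the one in the exponential series.\<close>

lemma (in stable_subordinator_space) expectation_ml_series:
  assumes c: "\<And>n. \<bar>c n\<bar> \<le> C ^ n" and t: "0 \<le> t"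
  shows "expectation (\<lambda>\<omega>. ml_series 1 c (inverse_subordinator V t \<omega>)) = ml_series \<alpha> c t"
proof -
  define f where "f = (\<lambda>n \<omega>. c n / fact n * inverse_subordinator V t \<omega> ^ n)"
  have fact: "Gamma (1 * real n + 1) = fact n" for n using Gamma_fact[of n] by (simp add: add.commute)
  have abs: "norm (f n \<omega>) = \<bar>c n\<bar> / fact n * inverse_subordinator V t \<omega> ^ n" for n \<omega>
    by (simp add: f_def abs_mult inverse_subordinator_nonneg)
  have f_int: "integrable M (f n)" for n
    unfolding f_def by (intro integrable_mult_right integrable_power_E t)
  have f_exp: "(LINT \<omega>|M. d / fact n * inverse_subordinator V t \<omega> ^ n) = d / Gamma (\<alpha> * real n + 1) * (t powr \<alpha>) ^ n" for d n
    using moment_E[OF t, of n] by simp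
  have sum1: "AE \<omega> in M. summable (\<lambda>n. norm (f n \<omega>))"
  proof (rule AE_I2)
    show "summable (\<lambda>n. norm (f n \<omega>))" for \<omega>
      using ml_summable[of 1 c C "inverse_subordinator V t \<omega>", OF _ c]
      unfolding abs fact by (simp add: inverse_subordinator_nonneg)
  qed
  have sum2: "summable (\<lambda>n. LINT \<omega>|M. norm (f n \<omega>))"
    unfolding abs f_exp using ml_summable[OF \<alpha>(1) c, of "t powr \<alpha>"] by simp
  have "ml_series 1 c (inverse_subordinator V t \<omega>) = (\<Sum>n. f n \<omega>)" for \<omega>
    unfolding ml_series_def fact f_def by (simp add: inverse_subordinator_nonneg)
  then have "expectation (\<lambda>\<omega>. ml_series 1 c (inverse_subordinator V t \<omega>)) = (\<Sum>n. integral\<^sup>L M (f n))"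
    using integral_suminf[OF f_int sum1 sum2] by simp
  also have "\<dots> = ml_series \<alpha> c t" unfolding f_def f_exp ml_series_def ..
  finally show ?thesis .
qed

text \<open>The time-changed probabilities equal the series and hence solve the system; uniqueness
  then equates them with any other solution. The first conjunct exhibits a solution, so the second
  is not vacuous.\<close>

theorem theorem2p2:
  fixes M :: "'a measure"
    and \<alpha> lam \<mu> :: real
    and i :: nat
    and N :: "real \<Rightarrow> 'a \<Rightarrow> nat"
    and V E :: "real \<Rightarrow> 'a \<Rightarrow> real"
  assumes "prob_space M"
    and "0 < \<alpha>" and "\<alpha> \<le> 1"
    and "0 < lam" and "0 < \<mu>"
    and "MM1_queue M lam \<mu> i N"
    and "stable_subordinator M \<alpha> V"
    and "E = inverse_subordinator V"
    and "indep_processes M (count_space UNIV) N borel E"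
  shows "fractional_MM1_queue M \<alpha> lam \<mu> i (\<lambda>t \<omega>. N (E t \<omega>) \<omega>) \<and>
         (\<forall>p. fractional_MM1_probs \<alpha> lam \<mu> i p \<longrightarrow>
           (\<forall>k. \<forall>t\<ge>0. measure M {\<omega> \<in> space M. N (E t \<omega>) \<omega> = k} = p k t))"
proof -
  interpret stable_subordinator_space M \<alpha> V
    by (intro stable_subordinator_space.intro stable_subordinator_space_axioms.intro assms)
  note \<alpha> = assms(2,3) and rates = assms(4,5)
  define p where "p = (\<lambda>k s. prob {\<omega> \<in> space M. N s \<omega> = k})"
  define q where "q = (\<lambda>k t. prob {\<omega> \<in> space M. N (E t \<omega>) \<omega> = k})"
  have E: "E = inverse_subordinator V" by fact
  have N: "N s \<in> measurable M (count_space UNIV)" if "0 \<le> s" for s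
    using assms(6) that by (simp add: MM1_queue_def fractional_MM1_queue_def)
  have p: "fractional_MM1_probs 1 lam \<mu> i p"
    using assms(6) by (simp add: MM1_queue_def fractional_MM1_queue_def p_def)
  have p_series: "p k s = ml_series 1 (\<lambda>n. MM1_coeff lam \<mu> i n k) s" if "0 \<le> s" for k s
    using fractional_MM1_probs_eq_series[OF _ _ rates p that] by simp
  have indep: "prob ({\<omega> \<in> space M. E t \<omega> \<in> A} \<inter> {\<omega> \<in> space M. N s \<omega> = k}) =
      prob {\<omega> \<in> space M. E t \<omega> \<in> A} * prob {\<omega> \<in> space M. N s \<omega> = k}"
    if "0 \<le> t" "0 \<le> s" "A \<in> sets borel" for t s A k
  proof -
    have "N s -` {k} \<inter> space M \<in> process_sigma M (count_space UNIV) N"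
      unfolding process_sigma_def using that by (intro sigma_sets.Basic) auto
    moreover have "E t -` A \<inter> space M \<in> process_sigma M borel E"
      unfolding process_sigma_def using that by (intro sigma_sets.Basic) auto
    ultimately have "prob ((N s -` {k} \<inter> space M) \<inter> (E t -` A \<inter> space M)) =
        prob (N s -` {k} \<inter> space M) * prob (E t -` A \<inter> space M)"
      using assms(9) unfolding indep_processes_def by (intro indep_setD)
    moreover have "{\<omega> \<in> space M. N s \<omega> = k} = N s -` {k} \<inter> space M"
      "{\<omega> \<in> space M. E t \<omega> \<in> A} = E t -` A \<inter> space M" by auto
    ultimately show ?thesis by (simp only: Int_commute mult.commute)
  qed
  have change: "{\<omega> \<in> space M. N (E t \<omega>) \<omega> = k} \<in> events \<and> q k t = expectation (\<lambda>\<omega>. p k (E t \<omega>))"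
    if "0 \<le> t" for k t
  proof -
    have rc: "continuous (at_right s) (\<lambda>s. N s \<omega>)" if "\<omega> \<in> space M" "0 \<le> s" for s \<omega>
      using assms(6) that by (simp add: MM1_queue_def)
    have meas: "E t \<in> borel_measurable M" unfolding E by (rule E_measurable)
    have nonneg: "0 \<le> E t \<omega>" for \<omega> unfolding E by (rule inverse_subordinator_nonneg)
    have cont: "continuous_on {0..} (\<lambda>s. prob {\<omega> \<in> space M. N s \<omega> = k})"
      using p by (simp add: fractional_MM1_probs_def caputo_differentiable_def p_def)
    show ?thesis
      using prob_independent_time_change[OF N rc meas nonneg indep[OF that] cont]
      unfolding p_def q_def by blast
  qed
  have q_series: "q k t = ml_series \<alpha> (\<lambda>n. MM1_coeff lam \<mu> i n k) t" if "0 \<le> t" for k t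
  proof -
    have "q k t = expectation (\<lambda>\<omega>. ml_series 1 (\<lambda>n. MM1_coeff lam \<mu> i n k) (inverse_subordinator V t \<omega>))"
      using change[OF that] by (simp add: p_series E inverse_subordinator_nonneg)
    also have "\<dots> = ml_series \<alpha> (\<lambda>n. MM1_coeff lam \<mu> i n k) t"
      by (rule expectation_ml_series[OF MM1_coeff_bound[OF rates] that])
    finally show ?thesis .
  qed
  \<comment> \<open>Total mass 1 comes from the events N (E t) = k, which are measurable by the time
    change and partition the space, rather than from the series.\<close>
  have q_sums: "(\<lambda>k. q k t) sums 1" if "0 \<le> t" for t
  proof -
    let ?A = "\<lambda>k. {\<omega> \<in> space M. N (E t \<omega>) \<omega> = k}"
    have "(\<lambda>k. prob (?A k)) sums prob (\<Union>k. ?A k)"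
      using change[OF that] by (intro finite_measure_UNION) (auto simp: disjoint_family_on_def)
    moreover have "(\<Union>k. ?A k) = space M" by auto
    ultimately show ?thesis by (simp add: q_def prob_space)
  qed
  have "fractional_MM1_probs \<alpha> lam \<mu> i q"
    by (rule fractional_MM1_probs_of_series[OF \<alpha> rates _ q_sums q_series]) (simp add: q_def)
  moreover have "(\<lambda>\<omega>. N (E t \<omega>) \<omega>) \<in> measurable M (count_space UNIV)" if "0 \<le> t" for t
  proof -
    have "(\<lambda>\<omega>. N (E t \<omega>) \<omega>) -` {k} \<inter> space M = {\<omega> \<in> space M. N (E t \<omega>) \<omega> = k}" for k by auto
    then show ?thesis using change[OF that] by (subst measurable_count_space_eq2_countable) auto
  qed
  ultimately have "fractional_MM1_queue M \<alpha> lam \<mu> i (\<lambda>t \<omega>. N (E t \<omega>) \<omega>)"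
    by (simp add: fractional_MM1_queue_def q_def)
  moreover have "q k t = p' k t" if "fractional_MM1_probs \<alpha> lam \<mu> i p'" "0 \<le> t" for p' k t
    using fractional_MM1_probs_eq_series[OF \<alpha> rates that] q_series[OF that(2)] by simp
  ultimately show ?thesis by (simp add: q_def)
qed

end
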